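(* Let $A\in\mathbb{C}^{n\times n}$ be a matrix all of whose eigenvalues have negative real part, let $\mathcal{S}\subset\mathbb{C}^{n\times n}$ be a complex-linear or real-linear subspace, let $0<\varepsilon<\varepsilon_\star$, where $\varepsilon_\star$ is the (unstructured) stability radius of $A$, and let $\delta_\varepsilon^{\mathcal{S}}(A)$ be the $\mathcal{S}$-structured $\varepsilon$-stability radius of $A$. Then for all perturbations $\Delta\in\mathcal{S}$ with $\|\Delta\|_F\le\delta_\varepsilon^{\mathcal{S}}(A)$, solutions to the inhomogeneous linear differential equations $$ y_\Delta'(t)=(A+\Delta)\,y_\Delta(t)+f(t),\qquad y_\Delta(0)=0, $$ share the bound (with $\|\cdot\|$ the Euclidean norm on $\mathbb{C}^n$) $$ \biggl(\int_0^T \|y_\Delta(t)\|^2\,dt\biggr)^{1/2}\le \frac1\varepsilon\,\biggl(\int_0^T\|f(t)\|^2\,dt\biggr)^{1/2},\qquad 0\le T\le\infty . $$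
   Context: $\|\cdot\|_F$ is the Frobenius norm. For $\varepsilon>0$ and $M\in\mathbb{C}^{n\times n}$, the unstructured $\varepsilon$-pseudospectrum of $M$ is $$\Lambda_\varepsilon(M)=\{\lambda\in\mathbb{C}: \lambda \text{ is an eigenvalue of } M+\Theta \text{ for some } \Theta\in\mathbb{C}^{n\times n} \text{ with } \|\Theta\|_F\le\varepsilon\}.$$ The stability radius $\varepsilon_\star=\varepsilon_\star(A)$ is the largest $\varepsilon>0$ such that $\Lambda_\varepsilon(A)$ has no points of positive real part. For $0<\varepsilon<\varepsilon_\star$, the $\mathcal{S}$-structured $\varepsilon$-stability radius $\delta_\varepsilon^{\mathcal{S}}(A)$ is the largest $\delta>0$ such that for every $\Delta\in\mathcal{S}$ with $\|\Delta\|_F\le\delta$, the pseudospectrum $\Lambda_\varepsilon(A+\Delta)$ has no points with positive real part. In the differential equation, $f(t)\in\mathbb{C}^n$ is the inhomogeneity, the same for all $\Delta$, and $y_\Delta(t)\in\mathbb{C}^n$ is the solution. *)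

theory Defs
  imports "HOL-Analysis.Analysis"
begin

text \<open>Elements of \<open>complex^'n^'n\<close> carry the norm of nested Euclidean products, which is
  the Frobenius norm.\<close>

lemma norm_eq_frobenius:
  fixes M :: "complex^'n^'m"
  shows "norm M = sqrt (\<Sum>i\<in>UNIV. \<Sum>j\<in>UNIV. (cmod (M $ i $ j))\<^sup>2)"
  by (simp add: norm_vec_def L2_set_def sum_nonneg)

text \<open>The constant \<^const>\<open>subspace\<close> refers to real scalars; this includes the complex-linear
  subspaces.\<close>

lemma complex_linear_imp_subspace:
  fixes S :: "(complex^'n^'m) set"
  assumes "0 \<in> S"
    and "\<And>M N. M \<in> S \<Longrightarrow> N \<in> S \<Longrightarrow> M + N \<in> S"
    and "\<And>c M. M \<in> S \<Longrightarrow> (\<chi> i j. c * M $ i $ j) \<in> S"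
  shows "subspace S"
proof -
  have "r *\<^sub>R M \<in> S" if "M \<in> S" for r M
  proof -
    have "r *\<^sub>R M = (\<chi> i j. complex_of_real r * M $ i $ j)"
      by (simp add: vec_eq_iff scaleR_conv_of_real[where 'a = complex])
    then show ?thesis using assms(3)[OF that] by simp
  qed
  then show ?thesis using assms(1,2) by (simp add: subspace_def)
qed

definition eigenvalue :: "complex^'n^'n \<Rightarrow> complex \<Rightarrow> bool" where
  "eigenvalue M \<mu> \<longleftrightarrow> (\<exists>v. v \<noteq> 0 \<and> M *v v = \<mu> *s v)"

definition pseudospectrum :: "real \<Rightarrow> complex^'n^'n \<Rightarrow> complex set" where
  "pseudospectrum \<epsilon> M = {\<mu>. \<exists>\<Theta>. norm \<Theta> \<le> \<epsilon> \<and> eigenvalue (M + \<Theta>) \<mu>}"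

definition stability_radius :: "complex^'n^'n \<Rightarrow> real" where
  "stability_radius A =
    (GREATEST \<epsilon>. 0 < \<epsilon> \<and> \<not> (\<exists>\<mu>\<in>pseudospectrum \<epsilon> A. Re \<mu> > 0))"

text \<open>The radius is an extended real: it is \<open>\<infinity>\<close> if no perturbation in \<open>S\<close> of any size moves the
  \<open>\<epsilon>\<close>-pseudospectrum into the open right half-plane, for example if \<open>S = {0}\<close>.\<close>

definition structured_stability_radius ::
  "(complex^'n^'n) set \<Rightarrow> real \<Rightarrow> complex^'n^'n \<Rightarrow> ereal" where
  "structured_stability_radius S \<epsilon> A =
    (GREATEST \<delta>. 0 < \<delta> \<and>
       (\<forall>\<Delta>\<in>S. ereal (norm \<Delta>) \<le> \<delta> \<longrightarrow> \<not> (\<exists>\<mu>\<in>pseudospectrum \<epsilon> (A + \<Delta>). Re \<mu> > 0)))"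

text \<open>Absolute continuity of a function on \<open>[a, b]\<close>; a pair \<open>(u, v)\<close> in \<open>I\<close> stands for the
  interval \<open>[u, v]\<close>. (The library constant \<^const>\<open>absolutely_continuous\<close> is about measures.)\<close>

definition abs_continuous_between :: "real \<Rightarrow> real \<Rightarrow> (real \<Rightarrow> 'a::real_normed_vector) \<Rightarrow> bool" where
  "abs_continuous_between a b y \<longleftrightarrow>
    (\<forall>e>0. \<exists>d>0. \<forall>I.
       finite I \<and> (\<forall>(u, v)\<in>I. a \<le> u \<and> u \<le> v \<and> v \<le> b) \<and>
       pairwise (\<lambda>(u, v) (u', v'). {u<..<v} \<inter> {u'<..<v'} = {}) I \<and>
       (\<Sum>(u, v)\<in>I. v - u) < d \<longrightarrow>
       (\<Sum>(u, v)\<in>I. norm (y v - y u)) < e)"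

text \<open>Solutions on \<open>[0, \<infinity>)\<close> of \<open>y' = M y + f\<close>, \<open>y(0) = 0\<close>, in the sense of Caratheodory, so that
  discontinuous inhomogeneities are admitted; continuously differentiable solutions are a special
  case. No hypothesis on \<open>f\<close> is needed: the equation forces \<open>f\<close> to be Lebesgue measurable and
  locally integrable on \<open>[0, \<infinity>)\<close>.\<close>

definition solves_ivp ::
  "complex^'n^'n \<Rightarrow> (real \<Rightarrow> complex^'n) \<Rightarrow> (real \<Rightarrow> complex^'n) \<Rightarrow> bool" where
  "solves_ivp M f y \<longleftrightarrow>
    y 0 = 0 \<and>
    (\<forall>b\<ge>0. abs_continuous_between 0 b y) \<and>
    (AE t in lebesgue. t > 0 \<longrightarrow> (y has_vector_derivative (M *v y t + f t)) (at t))"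

definition ennreal_sqrt :: "ennreal \<Rightarrow> ennreal" where
  "ennreal_sqrt x = (if x = \<infinity> then \<infinity> else ennreal (sqrt (enn2real x)))"

definition L2_norm_upto :: "ereal \<Rightarrow> (real \<Rightarrow> complex^'n) \<Rightarrow> ennreal" where
  "L2_norm_upto T g =
    ennreal_sqrt (\<integral>\<^sup>+t\<in>{t. 0 \<le> t \<and> ereal t \<le> T}. ennreal ((norm (g t))\<^sup>2) \<partial>lebesgue)"

end

theory Submission
  imports Defs "HOL-Complex_Analysis.Conformal_Mappings"
begin

text \<open>That \<open>\<Lambda>\<^sub>\<epsilon>(M)\<close> has no points of positive real part means \<open>\<epsilon> \<parallel>v\<parallel> \<le> \<parallel>(z - M) v\<parallel>\<close> for all \<open>v\<close> and
  all \<open>z\<close> in the right half-plane: equality is excluded by the maximum principle for the resolvent.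
  This condition is closed in \<open>\<epsilon>\<close> and \<open>M\<close>, so the two stability radii are attained and the bound holds
  for \<open>M = A + \<Delta>\<close>.

  Instead of the Fourier transform and Plancherel's theorem, the \<open>L\<^sup>2\<close> estimate is derived from the
  implicit Euler scheme. Its symbol \<open>(1 - w) / h\<close> maps the unit disc into the right half-plane, so
  Parseval's identity for polynomials on the unit circle gives the discrete estimate for every step
  size \<open>h\<close>. Sampling the solution on a grid produces such a scheme, whose inhomogeneity is the local
  mean of \<open>f\<close> up to the modulus of continuity of \<open>y\<close>, and \<open>h \<rightarrow> 0\<close> gives the continuous estimate.\<close>

section \<open>Pseudospectra and the resolvent\<close>

lemma norm_vec_power2:
  fixes v :: "complex^'n"
  shows "(norm v)\<^sup>2 = (\<Sum>i\<in>UNIV. (cmod (v $ i))\<^sup>2)"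
  by (simp add: norm_vec_def L2_set_def sum_nonneg)

lemma cmod_sum_mult_le:
  fixes x y :: "complex^'n"
  shows "cmod (\<Sum>i\<in>UNIV. x $ i * y $ i) \<le> norm x * norm y"
proof -
  have "cmod (\<Sum>i\<in>UNIV. x $ i * y $ i) \<le> (\<Sum>i\<in>UNIV. \<bar>cmod (x $ i)\<bar> * \<bar>cmod (y $ i)\<bar>)"
    by (rule order_trans[OF norm_sum]) (simp add: norm_mult)
  also have "\<dots> \<le> norm x * norm y"
    unfolding norm_vec_def by (rule L2_set_mult_ineq)
  finally show ?thesis .
qed

lemma norm_matrix_vector_mult_le:
  fixes M :: "complex^'n^'m"
  shows "norm (M *v v) \<le> norm M * norm v"
proof -
  have "norm (M *v v) \<le> L2_set (\<lambda>i. norm (M $ i) * norm v) UNIV"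
    unfolding norm_vec_def[of "M *v v"]
    by (intro L2_set_mono) (simp_all add: matrix_vector_mult_def cmod_sum_mult_le)
  also have "\<dots> = norm M * norm v"
    by (simp add: norm_vec_def[of M] L2_set_left_distrib)
  finally show ?thesis .
qed

lemma norm_vector_scalar_mult:
  fixes v :: "complex^'n"
  shows "norm (c *s v) = cmod c * norm v"
  by (simp add: norm_vec_def norm_mult L2_set_right_distrib)

text \<open>Cramer's rule: the components are quotients of determinants with holomorphic entries,
  and \<open>inj\<close> makes the denominator nonzero. The general symbol \<open>c\<close> covers
  both the resolvent itself (\<open>c w = w\<close>) and the Euler symbol on the disc.\<close>

lemma resolvent_holomorphic:
  fixes M :: "complex^'n^'n" and b :: "complex^'n"
  assumes "c holomorphic_on U"
    and inj: "\<And>w v. w \<in> U \<Longrightarrow> v \<noteq> 0 \<Longrightarrow> c w *s v - M *v v \<noteq> 0"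
  obtains x where "\<And>i. (\<lambda>w. x w $ i) holomorphic_on U"
    and "\<And>w. w \<in> U \<Longrightarrow> c w *s x w - M *v x w = b"
proof -
  define B where "B w = mat (c w) - M" for w
  define x where
    "x w = (\<chi> k. det (\<chi> i j. if j = k then b $ i else B w $ i $ j) / det (B w))" for w
  have B: "B w *v v = c w *s v - M *v v" for w v
    by (simp add: B_def matrix_vector_mult_diff_rdistrib)
       (simp add: vec_eq_iff matrix_vector_mult_def mat_def if_distrib if_distribR sum.delta cong: if_cong)
  have det: "det (B w) \<noteq> 0" if "w \<in> U" for w
  proof -
    have "\<forall>v. B w *v v = 0 \<longrightarrow> v = 0"
      using inj[OF that] by (auto simp: B)
    then show ?thesis
      by (metis matrix_left_invertible_ker invertible_left_inverse invertible_det_nz)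
  qed
  have entry: "(\<lambda>w. B w $ i $ j) holomorphic_on U" for i j
    unfolding B_def mat_def using assms(1)
    by (cases "i = j") (auto intro!: holomorphic_intros)
  have entry': "(\<lambda>w. if j = k then b $ i else B w $ i $ j) holomorphic_on U" for i j k
    by (cases "j = k") (auto intro: entry)
  have "(\<lambda>w. x w $ k) holomorphic_on U" for k
    unfolding x_def det_def vec_lambda_beta using det
    by (auto intro!: holomorphic_intros entry entry' simp: det_def)
  moreover have "c w *s x w - M *v x w = b" if "w \<in> U" for w
    using cramer[OF det[OF that], of "x w" b] by (simp add: x_def flip: B)
  ultimately show ?thesis using that by blast
qed

text \<open>An eigenvector of \<open>M + \<Theta>\<close> has residual \<open>\<Theta> *v v\<close>.
  Conversely, a rank-one perturbation absorbs any residual; its Frobenius and spectral norms agree,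
  which is why the Frobenius ball leads to a condition on Euclidean norms alone.\<close>

lemma mem_pseudospectrum_iff:
  fixes M :: "complex^'n^'n"
  assumes "0 \<le> \<epsilon>"
  shows "\<mu> \<in> pseudospectrum \<epsilon> M \<longleftrightarrow> (\<exists>v. v \<noteq> 0 \<and> norm (\<mu> *s v - M *v v) \<le> \<epsilon> * norm v)"
proof
  assume "\<mu> \<in> pseudospectrum \<epsilon> M"
  then obtain \<Theta> v where \<Theta>: "norm \<Theta> \<le> \<epsilon>" and v: "v \<noteq> 0" "(M + \<Theta>) *v v = \<mu> *s v"
    by (auto simp: pseudospectrum_def eigenvalue_def)
  have "\<mu> *s v - M *v v = \<Theta> *v v"
    using v by (simp add: matrix_vector_mult_add_rdistrib flip: v(2))
  then have "norm (\<mu> *s v - M *v v) \<le> norm \<Theta> * norm v"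
    by (simp add: norm_matrix_vector_mult_le)
  also have "\<dots> \<le> \<epsilon> * norm v"
    using \<Theta> by (simp add: mult_right_mono)
  finally show "\<exists>v. v \<noteq> 0 \<and> norm (\<mu> *s v - M *v v) \<le> \<epsilon> * norm v"
    using v by blast
next
  assume "\<exists>v. v \<noteq> 0 \<and> norm (\<mu> *s v - M *v v) \<le> \<epsilon> * norm v"
  then obtain v where v: "v \<noteq> 0" "norm (\<mu> *s v - M *v v) \<le> \<epsilon> * norm v" by blast
  define u where "u = \<mu> *s v - M *v v"
  \<comment> \<open>The outer product of \<open>u\<close> with the conjugate of \<open>v\<close>,
    scaled so that it maps \<open>v\<close> to \<open>u\<close>; its Frobenius norm is
    \<open>norm u / norm v\<close>.\<close>
  define \<Theta> :: "complex^'n^'n" where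
    "\<Theta> = (\<chi> i j. u $ i * cnj (v $ j) / complex_of_real ((norm v)\<^sup>2))"
  have n: "norm v > 0" using v by simp
  have sum_v: "(\<Sum>j\<in>UNIV. cnj (v $ j) * v $ j) = complex_of_real ((norm v)\<^sup>2)"
    by (simp add: norm_vec_power2 complex_norm_square mult.commute del: of_real_power)
  have "\<Theta> *v v = u"
  proof -
    have "(\<Theta> *v v) $ i = u $ i" for i
    proof -
      have "(\<Theta> *v v) $ i = u $ i * (\<Sum>j\<in>UNIV. cnj (v $ j) * v $ j) / complex_of_real ((norm v)\<^sup>2)"
        by (simp add: \<Theta>_def matrix_vector_mult_def sum_distrib_left sum_divide_distrib mult_ac)
      also have "\<dots> = u $ i" using n by (simp add: sum_v)
      finally show ?thesis .
    qed
    then show ?thesis by (simp add: vec_eq_iff)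
  qed
  then have "(M + \<Theta>) *v v = \<mu> *s v"
    by (simp add: matrix_vector_mult_add_rdistrib u_def)
  moreover have "norm \<Theta> \<le> \<epsilon>"
  proof -
    have row: "norm (\<Theta> $ i) = cmod (u $ i) / norm v" for i
    proof -
      have "norm (\<Theta> $ i) = L2_set (\<lambda>j. (cmod (u $ i) / (norm v)\<^sup>2) * cmod (v $ j)) UNIV"
        unfolding norm_vec_def[of "\<Theta> $ i"]
        by (simp add: \<Theta>_def norm_mult norm_divide norm_power)
      also have "\<dots> = cmod (u $ i) / (norm v)\<^sup>2 * norm v"
        unfolding norm_vec_def[of v] by (rule L2_set_right_distrib[symmetric]) simp
      also have "\<dots> = cmod (u $ i) / norm v" using n by (simp add: power2_eq_square)
      finally show ?thesis .
    qed
    have "norm \<Theta> = L2_set (\<lambda>i. (1 / norm v) * cmod (u $ i)) UNIV"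
      by (simp add: norm_vec_def[of \<Theta>] row)
    also have "\<dots> = 1 / norm v * norm u"
      unfolding norm_vec_def[of u] by (rule L2_set_right_distrib[symmetric]) simp
    also have "\<dots> \<le> \<epsilon>"
      using v n by (simp add: u_def field_simps)
    finally show ?thesis .
  qed
  ultimately show "\<mu> \<in> pseudospectrum \<epsilon> M"
    using v by (auto simp: pseudospectrum_def eigenvalue_def)
qed

text \<open>For \<open>\<epsilon> > 0\<close> this is the bound \<open>1 / \<epsilon>\<close> for
  the resolvent on the open right half-plane. Without the inverse it is a family of weak
  inequalities, meaningful for every real \<open>\<epsilon>\<close> and stable under limits.\<close>

definition resolvent_bounded :: "real \<Rightarrow> complex^'n^'n \<Rightarrow> bool" where
  "resolvent_bounded \<epsilon> M \<longleftrightarrow>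
    (\<forall>z v. Re z > 0 \<longrightarrow> \<epsilon> * norm v \<le> norm (z *s v - M *v v))"

text \<open>If \<open>u = (\<zeta> - M) v\<close> attained the bound, then \<open>z \<mapsto> \<langle>(z - M)\<^sup>-\<^sup>1 u, v\<rangle>\<close> would have maximal
  modulus at \<open>\<zeta>\<close>, hence be constant, although it tends to \<open>0\<close> at infinity.\<close>

lemma resolvent_bounded_strict:
  fixes M :: "complex^'n^'n"
  assumes M: "resolvent_bounded \<epsilon> M" and \<epsilon>: "0 < \<epsilon>" and \<zeta>: "0 < Re \<zeta>" and v: "v \<noteq> 0"
  shows "\<epsilon> * norm v < norm (\<zeta> *s v - M *v v)"
proof (rule ccontr)
  define u where "u = \<zeta> *s v - M *v v"
  assume "\<not> ?thesis"
  then have u: "norm u = \<epsilon> * norm v"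
    using M \<zeta> unfolding resolvent_bounded_def u_def by (meson antisym not_le)
  define U where "U = {z::complex. Re z > 0}"
  have bound: "\<epsilon> * norm v \<le> norm (z *s v - M *v v)" if "z \<in> U" for z v
    using M that by (simp add: resolvent_bounded_def U_def)
  have inj: "z *s v - M *v v \<noteq> 0" if "z \<in> U" "v \<noteq> 0" for z v
    using bound[of z v] that \<epsilon> by (smt (verit) norm_eq_zero mult_pos_pos zero_less_norm_iff)
  obtain x where hol: "\<And>i. (\<lambda>w. x w $ i) holomorphic_on U"
    and x: "\<And>w. w \<in> U \<Longrightarrow> w *s x w - M *v x w = u"
    by (rule resolvent_holomorphic[of "\<lambda>w. w" U M u]) (use inj in \<open>auto intro: holomorphic_intros\<close>)
  define g where "g z = (\<Sum>i\<in>UNIV. x z $ i * (\<chi> i. cnj (v $ i)) $ i)" for z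
  have norm_cnj: "norm (\<chi> i. cnj (v $ i)) = norm v"
    by (simp add: norm_vec_def)
  have g_le: "cmod (g z) \<le> norm (x z) * norm v" for z
    unfolding g_def using cmod_sum_mult_le[of "x z" "\<chi> i. cnj (v $ i)"] by (simp only: norm_cnj)
  have x_le: "norm (x z) \<le> norm v" if "z \<in> U" for z
  proof -
    have "\<epsilon> * norm (x z) \<le> \<epsilon> * norm v" using bound[OF that, of "x z"] x[OF that] u by simp
    then show ?thesis using \<epsilon> by simp
  qed
  have \<zeta>U: "\<zeta> \<in> U" using \<zeta> by (simp add: U_def)
  have "\<zeta> *s (x \<zeta> - v) - M *v (x \<zeta> - v) = 0"
    using x[OF \<zeta>U] by (simp add: u_def vec.scale_right_diff_distrib matrix_vector_mult_diff_distrib algebra_simps)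
  then have "x \<zeta> = v" using inj[OF \<zeta>U, of "x \<zeta> - v"] by auto
  then have g\<zeta>: "g \<zeta> = complex_of_real ((norm v)\<^sup>2)"
    by (simp add: g_def norm_vec_power2 complex_norm_square del: of_real_power)
  have "g constant_on U"
  proof (rule maximum_modulus_principle[where U = U and \<xi> = \<zeta>])
    show "g holomorphic_on U" unfolding g_def by (intro holomorphic_intros hol)
    show "open U" unfolding U_def by (rule open_halfspace_Re_gt)
    show "connected U" unfolding U_def by (intro convex_connected convex_halfspace_Re_gt)
    show "cmod (g z) \<le> cmod (g \<zeta>)" if "z \<in> U" for z
    proof -
      have "cmod (g z) \<le> norm v * norm v"
        using g_le[of z] x_le[OF that] by (meson mult_right_mono norm_ge_zero order_trans)
      then show ?thesis by (simp add: g\<zeta> power2_eq_square norm_mult)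
    qed
  qed (use \<zeta>U in \<open>auto simp: U_def open_halfspace_Re_gt\<close>)
  then have const: "g z = complex_of_real ((norm v)\<^sup>2)" if "z \<in> U" for z
    using that \<zeta>U g\<zeta> by (metis constant_on_def)
  \<comment> \<open>One large point replaces the limit at infinity: at \<open>z = r\<close> the
    equation gives \<open>(\<epsilon> + 1) * norm (x z) \<le> \<epsilon> * norm v\<close>, while
    constancy of \<open>g\<close> forces \<open>norm v \<le> norm (x z)\<close>.\<close>
  define r where "r = norm M + \<epsilon> + 1"
  define z where "z = complex_of_real r"
  have r: "r > 0" using \<epsilon> by (simp add: r_def add_nonneg_pos)
  then have zU: "z \<in> U" by (simp add: z_def U_def)
  have "r * norm (x z) = norm (z *s x z)"
    using r by (simp add: norm_vector_scalar_mult z_def)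
  also have "z *s x z = u + M *v x z" using x[OF zU] by (simp add: algebra_simps)
  also have "norm (u + M *v x z) \<le> \<epsilon> * norm v + norm M * norm (x z)"
    using norm_triangle_ineq[of u "M *v x z"] norm_matrix_vector_mult_le[of M "x z"] u by linarith
  finally have "(\<epsilon> + 1) * norm (x z) \<le> \<epsilon> * norm v" by (simp add: r_def algebra_simps)
  moreover have "norm v \<le> norm (x z)"
  proof -
    have "norm v * norm v \<le> norm (x z) * norm v"
      using g_le[of z] const[OF zU] by (simp add: norm_mult power2_eq_square)
    then show ?thesis using v by simp
  qed
  ultimately have "(\<epsilon> + 1) * norm v \<le> \<epsilon> * norm v"
    using \<epsilon> by (smt (verit) mult_left_mono)
  then show False using v by (simp add: algebra_simps)
qed

text \<open>Absence from the pseudospectrum is a strict inequality, the resolvent bound a weak one;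
  \<open>resolvent_bounded_strict\<close> closes the gap.\<close>

lemma pseudospectrum_right_half_plane_iff:
  fixes M :: "complex^'n^'n"
  assumes "0 < \<epsilon>"
  shows "\<not> (\<exists>\<mu>\<in>pseudospectrum \<epsilon> M. Re \<mu> > 0) \<longleftrightarrow> resolvent_bounded \<epsilon> M"
proof
  assume "\<not> (\<exists>\<mu>\<in>pseudospectrum \<epsilon> M. Re \<mu> > 0)"
  then have "\<epsilon> * norm v < norm (z *s v - M *v v)" if "Re z > 0" "v \<noteq> 0" for z v
    using that assms by (auto simp: mem_pseudospectrum_iff not_le Bex_def)
  then show "resolvent_bounded \<epsilon> M"
    unfolding resolvent_bounded_def by (metis less_imp_le mult_zero_right norm_ge_zero norm_zero)
next
  assume "resolvent_bounded \<epsilon> M"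
  then show "\<not> (\<exists>\<mu>\<in>pseudospectrum \<epsilon> M. Re \<mu> > 0)"
    using resolvent_bounded_strict assms by (force simp: mem_pseudospectrum_iff)
qed

section \<open>Limits and perturbations of the resolvent bound, and attainment of the radii\<close>

lemma continuous_on_resolvent_norm:
  fixes M :: "complex^'n^'n"
  shows "continuous_on X (\<lambda>(z, v). norm (z *s v - M *v v))"
  unfolding split_def vector_scalar_mult_def
  by (intro continuous_intros continuous_on_vec_lambda
        bounded_linear.continuous_on[OF matrix_vector_mul_bounded_linear])

text \<open>Shift \<open>z\<close> to the right by \<open>t\<close> and let \<open>t\<close> tend to
  0. The boundary matters because the Euler symbol vanishes at \<open>w = 1\<close>.\<close>

lemma resolvent_bounded_closed_half_plane:
  fixes M :: "complex^'n^'n"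
  assumes "resolvent_bounded \<epsilon> M" and "0 \<le> Re z"
  shows "\<epsilon> * norm v \<le> norm (z *s v - M *v v)"
proof -
  have "((\<lambda>t::real. norm ((z + of_real t) *s v - M *v v)) \<longlongrightarrow> norm ((z + of_real 0) *s v - M *v v)) (at_right 0)"
    unfolding vector_scalar_mult_def by (intro tendsto_intros tendsto_vec_lambda)
  then have "((\<lambda>t::real. norm ((z + of_real t) *s v - M *v v)) \<longlongrightarrow> norm (z *s v - M *v v)) (at_right 0)"
    by simp
  moreover have "\<forall>\<^sub>F t in at_right 0. \<epsilon> * norm v \<le> norm ((z + of_real t) *s v - M *v v)"
  proof (rule eventually_mono[OF eventually_at_right_less])
    fix t :: real assume "0 < t"
    then have "0 < Re (z + of_real t)" using assms by simp
    then show "\<epsilon> * norm v \<le> norm ((z + of_real t) *s v - M *v v)"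
      using assms(1) unfolding resolvent_bounded_def by blast
  qed
  ultimately show ?thesis by (rule tendsto_lowerbound) simp
qed

lemma resolvent_bounded_antimono:
  assumes "resolvent_bounded \<epsilon>' M" and "\<epsilon> \<le> \<epsilon>'"
  shows "resolvent_bounded \<epsilon> M"
  using assms unfolding resolvent_bounded_def by (meson mult_right_mono norm_ge_zero order_trans)

text \<open>By the triangle inequality the bound is 1-Lipschitz in the matrix. This gives room for
  small structured perturbations and a passage to the limit in the matrix.\<close>

lemma resolvent_bounded_perturb:
  fixes A \<Delta> :: "complex^'n^'n"
  assumes "resolvent_bounded \<epsilon> A"
  shows "resolvent_bounded (\<epsilon> - norm \<Delta>) (A + \<Delta>)"
  unfolding resolvent_bounded_def
proof (intro allI impI)
  fix z :: complex and v :: "complex^'n"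
  assume "Re z > 0"
  then have "\<epsilon> * norm v \<le> norm (z *s v - A *v v)"
    using assms by (simp add: resolvent_bounded_def)
  also have "\<dots> \<le> norm (z *s v - (A + \<Delta>) *v v) + norm (\<Delta> *v v)"
    by (rule order_trans[OF _ norm_triangle_ineq]) (simp add: matrix_vector_mult_add_rdistrib)
  also have "norm (\<Delta> *v v) \<le> norm \<Delta> * norm v" by (rule norm_matrix_vector_mult_le)
  finally show "(\<epsilon> - norm \<Delta>) * norm v \<le> norm (z *s v - (A + \<Delta>) *v v)"
    by (simp add: algebra_simps)
qed

text \<open>Each inequality is continuous in \<open>\<epsilon>\<close> and survives the limit from
  below; this turns suprema of admissible radii into maxima.\<close>

lemma resolvent_bounded_limit:
  fixes M :: "complex^'n^'n"
  assumes "\<And>\<epsilon>'. \<epsilon>' < \<epsilon> \<Longrightarrow> resolvent_bounded \<epsilon>' M"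
  shows "resolvent_bounded \<epsilon> M"
  unfolding resolvent_bounded_def
proof (intro allI impI)
  fix z :: complex and v :: "complex^'n"
  assume z: "Re z > 0"
  have "((\<lambda>e. e * norm v) \<longlongrightarrow> \<epsilon> * norm v) (at_left \<epsilon>)"
    by (intro tendsto_intros)
  moreover have "\<forall>\<^sub>F e in at_left \<epsilon>. e * norm v \<le> norm (z *s v - M *v v)"
    by (rule eventually_at_leftI[of "\<epsilon> - 1"]) (use assms z in \<open>auto simp: resolvent_bounded_def\<close>)
  ultimately show "\<epsilon> * norm v \<le> norm (z *s v - M *v v)"
    by (rule tendsto_upperbound) simp
qed

text \<open>Compactness: on a closed half-disc times the unit sphere the residual norm attains its
  minimum \<open>F p\<close>, which is positive because a zero would be an eigenvalue with
  nonnegative real part. Outside the radius \<open>R = norm A + 1\<close> the residual is at least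
  \<open>norm v\<close>.\<close>

lemma stable_imp_resolvent_bounded:
  fixes A :: "complex^'n^'n"
  assumes "\<And>\<mu>. eigenvalue A \<mu> \<Longrightarrow> Re \<mu> < 0"
  obtains c where "0 < c" and "resolvent_bounded c A"
proof -
  define R where "R = norm A + 1"
  define K where "K = ({z. 0 \<le> Re z} \<inter> cball 0 R) \<times> (sphere 0 1 :: (complex^'n) set)"
  define F where "F = (\<lambda>(z, v). norm (z *s v - A *v v))"
  have "compact K" unfolding K_def
    by (intro compact_Times closed_Int_compact closed_halfspace_Re_ge) auto
  moreover have "K \<noteq> {}"
  proof -
    obtain b :: "complex^'n" where "b \<in> Basis" by (meson all_not_in_conv nonempty_Basis)
    then have "(0, b) \<in> K" by (simp add: K_def R_def)
    then show ?thesis by blast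
  qed
  moreover have "continuous_on K F" unfolding F_def by (rule continuous_on_resolvent_norm)
  ultimately obtain p where p: "p \<in> K" "\<And>q. q \<in> K \<Longrightarrow> F p \<le> F q"
    using continuous_attains_inf[of K F] by blast
  have "F p > 0"
  proof (rule ccontr)
    assume "\<not> F p > 0"
    then have "A *v snd p = fst p *s snd p" by (simp add: F_def split_def)
    moreover have "snd p \<noteq> 0" "Re (fst p) \<ge> 0" using p(1) by (auto simp: K_def)
    ultimately have "eigenvalue A (fst p)" unfolding eigenvalue_def by blast
    then show False using assms[of "fst p"] \<open>Re (fst p) \<ge> 0\<close> by simp
  qed
  moreover have "resolvent_bounded (min (F p) 1) A"
    unfolding resolvent_bounded_def
  proof (intro allI impI)
    fix z :: complex and v :: "complex^'n" assume z: "Re z > 0"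
    show "min (F p) 1 * norm v \<le> norm (z *s v - A *v v)"
    proof (cases "v = 0")
      case v: False
      show ?thesis
      proof (cases "cmod z \<le> R")
        case True
        define w where "w = (1 / norm v) *\<^sub>R v"
        have "(z, w) \<in> K" using z True v by (simp add: K_def w_def)
        then have "F p \<le> norm (z *s w - A *v w)" using p(2) by (fastforce simp: F_def)
        also have "z *s w - A *v w = (1 / norm v) *\<^sub>R (z *s v - A *v v)"
        proof -
          have "z *s w = (1 / norm v) *\<^sub>R (z *s v)"
            by (simp add: w_def vec_eq_iff)
          moreover have "A *v w = (1 / norm v) *\<^sub>R (A *v v)"
            unfolding w_def by (rule linear_simps(5)[OF matrix_vector_mul_bounded_linear])
          ultimately show ?thesis by (simp only: scaleR_right_diff_distrib)
        qed
        finally have "F p \<le> norm (z *s v - A *v v) / norm v" by simp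
        then have "F p * norm v \<le> norm (z *s v - A *v v)"
          using v by (simp add: pos_le_divide_eq)
        moreover have "min (F p) 1 * norm v \<le> F p * norm v" by (intro mult_right_mono) auto
        ultimately show ?thesis by simp
      next
        case False
        have "cmod z * norm v \<le> norm (z *s v - A *v v) + norm (A *v v)"
          using norm_triangle_ineq[of "z *s v - A *v v" "A *v v"] by (simp add: norm_vector_scalar_mult)
        moreover have "norm (A *v v) \<le> norm A * norm v" by (rule norm_matrix_vector_mult_le)
        moreover have "R * norm v \<le> cmod z * norm v" using False by (simp add: mult_right_mono)
        ultimately have "norm v \<le> norm (z *s v - A *v v)" by (simp add: R_def algebra_simps)
        moreover have "min (F p) 1 * norm v \<le> 1 * norm v" by (intro mult_right_mono) auto
        ultimately show ?thesis by simp
      qed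
    qed simp
  qed
  ultimately show ?thesis using that[of "min (F p) 1"] by simp
qed

text \<open>\<open>GREATEST\<close> is informative only if a greatest element exists. The admissible
  radii form a nonempty bounded set, and the limit lemma puts its supremum into it.\<close>

lemma resolvent_bounded_stability_radius:
  fixes A :: "complex^'n^'n"
  assumes "\<And>\<mu>. eigenvalue A \<mu> \<Longrightarrow> Re \<mu> < 0"
  shows "resolvent_bounded (stability_radius A) A"
proof -
  define E where "E = {\<epsilon>. 0 < \<epsilon> \<and> resolvent_bounded \<epsilon> A}"
  obtain c where c: "c \<in> E"
    using stable_imp_resolvent_bounded[OF assms] unfolding E_def by auto
  obtain b :: "complex^'n" where "b \<in> Basis" by (meson all_not_in_conv nonempty_Basis)
  then have b: "norm b = 1" by simp
  have "bdd_above E"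
  proof (rule bdd_aboveI)
    fix \<epsilon> assume "\<epsilon> \<in> E"
    \<comment> \<open>Testing one unit vector at \<open>z = 1\<close> bounds every admissible
      radius.\<close>
    then have "\<epsilon> * norm b \<le> norm (1 *s b - A *v b)"
      unfolding E_def resolvent_bounded_def by (metis (mono_tags, lifting) mem_Collect_eq one_complex.sel(1) zero_less_one)
    then show "\<epsilon> \<le> norm (1 *s b - A *v b)" using b by simp
  qed
  have pos: "0 < Sup E" using c cSup_upper[OF c \<open>bdd_above E\<close>] by (simp add: E_def)
  have "resolvent_bounded (Sup E) A"
  proof (rule resolvent_bounded_limit)
    fix e assume "e < Sup E"
    then obtain e' where "e' \<in> E" "e < e'" using c less_cSupE by blast
    then show "resolvent_bounded e A" by (auto simp: E_def intro: resolvent_bounded_antimono)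
  qed
  moreover have "stability_radius A = Sup E"
    unfolding stability_radius_def
  proof (rule Greatest_equality)
    show "0 < Sup E \<and> \<not> (\<exists>\<mu>\<in>pseudospectrum (Sup E) A. 0 < Re \<mu>)"
      using pos \<open>resolvent_bounded (Sup E) A\<close> pseudospectrum_right_half_plane_iff by blast
    show "y \<le> Sup E" if "0 < y \<and> \<not> (\<exists>\<mu>\<in>pseudospectrum y A. 0 < Re \<mu>)" for y
      using that pseudospectrum_right_half_plane_iff[of y A]
      by (intro cSup_upper \<open>bdd_above E\<close>) (simp add: E_def)
  qed
  ultimately show ?thesis by simp
qed

text \<open>The supremum of the admissible bounds, possibly infinite, is again admissible: shrinking
  \<open>D\<close> slightly within \<open>S\<close> brings its norm strictly below the supremum, and
  undoing the shrinking costs arbitrarily little.\<close>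

lemma resolvent_bounded_structured:
  fixes A \<Delta> :: "complex^'n^'n"
  assumes A: "resolvent_bounded \<epsilon>' A" and \<epsilon>: "0 < \<epsilon>" "\<epsilon> < \<epsilon>'" and S: "subspace S"
    and \<Delta>: "\<Delta> \<in> S" "ereal (norm \<Delta>) \<le> structured_stability_radius S \<epsilon> A"
  shows "resolvent_bounded \<epsilon> (A + \<Delta>)"
proof -
  define P where "P \<delta> \<longleftrightarrow> (\<forall>D\<in>S. ereal (norm D) \<le> \<delta> \<longrightarrow> resolvent_bounded \<epsilon> (A + D))" for \<delta>
  define E where "E = {\<delta>. 0 < \<delta> \<and> P \<delta>}"
  \<comment> \<open>The unstructured slack is an admissible bound; it makes the supremum positive,
    as the definition of the radius demands.\<close>
  have c: "ereal (\<epsilon>' - \<epsilon>) \<in> E"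
    unfolding E_def P_def mem_Collect_eq
  proof (intro conjI ballI impI)
    fix D :: "complex^'n^'n" assume "ereal (norm D) \<le> ereal (\<epsilon>' - \<epsilon>)"
    then show "resolvent_bounded \<epsilon> (A + D)"
      using resolvent_bounded_antimono[OF resolvent_bounded_perturb[OF A], of \<epsilon> D] by simp
  qed (use \<epsilon> in simp)
  have P: "P (Sup E)"
    unfolding P_def
  proof (intro ballI impI)
    fix D assume D: "D \<in> S" "ereal (norm D) \<le> Sup E"
    have small: "resolvent_bounded \<epsilon> (A + D')" 
      if D': "D' \<in> S" "ereal (norm D') < Sup E" for D'
    proof -
      obtain d where "d \<in> E" "ereal (norm D') < d" using D'(2) by (auto simp: less_Sup_iff)
      then show ?thesis using D'(1) unfolding E_def P_def by (blast intro: less_imp_le)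
    qed
    show "resolvent_bounded \<epsilon> (A + D)"
    \<comment> \<open>The zero matrix cannot be shrunk to a strictly smaller norm.\<close>
    proof (cases "D = 0")
      case True
      then show ?thesis using resolvent_bounded_antimono[OF A, of \<epsilon>] \<epsilon> by simp
    next
      case False
      show ?thesis
      proof (rule resolvent_bounded_limit)
        fix e assume e: "e < \<epsilon>"
        \<comment> \<open>The cap 1 keeps the factor \<open>1 - t\<close> nonnegative; the other
          term limits the loss \<open>t * norm D\<close> to \<open>\<epsilon> - e\<close>.\<close>
        define t where "t = min 1 ((\<epsilon> - e) / norm D)"
        have t: "0 < t" "t \<le> 1" "t * norm D \<le> \<epsilon> - e"
          using e False by (auto simp: t_def min_def field_simps)
        have "(1 - t) *\<^sub>R D \<in> S" using S D by (simp add: subspace_scale)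
        moreover have "norm ((1 - t) *\<^sub>R D) < norm D" using t False by simp
        then have "ereal (norm ((1 - t) *\<^sub>R D)) < Sup E"
          using D(2) order_less_le_trans[of "ereal (norm ((1 - t) *\<^sub>R D))" "ereal (norm D)" "Sup E"]
          by (simp only: less_ereal.simps)
        ultimately have "resolvent_bounded \<epsilon> (A + (1 - t) *\<^sub>R D)" by (rule small)
        then have "resolvent_bounded (\<epsilon> - norm (t *\<^sub>R D)) (A + (1 - t) *\<^sub>R D + t *\<^sub>R D)"
          by (rule resolvent_bounded_perturb)
        moreover have "A + (1 - t) *\<^sub>R D + t *\<^sub>R D = A + D" by (simp add: algebra_simps)
        ultimately show "resolvent_bounded e (A + D)"
          using t resolvent_bounded_antimono[of "\<epsilon> - norm (t *\<^sub>R D)" "A + D" e] by simp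
      qed
    qed
  qed
  have "structured_stability_radius S \<epsilon> A = Sup E"
    unfolding structured_stability_radius_def pseudospectrum_right_half_plane_iff[OF \<epsilon>(1)]
      P_def[symmetric]
  proof (rule Greatest_equality)
    have "0 < ereal (\<epsilon>' - \<epsilon>)" using \<epsilon> by simp
    also have "\<dots> \<le> Sup E" by (rule Sup_upper[OF c])
    finally show "0 < Sup E \<and> P (Sup E)" using P by blast
    show "y \<le> Sup E" if "0 < y \<and> P y" for y
      using that by (intro Sup_upper) (simp add: E_def)
  qed
  then show ?thesis using P \<Delta> by (simp add: P_def)
qed

section \<open>The implicit Euler scheme\<close>

lemma norm_circlepath_0_1: "cmod (circlepath 0 1 t) = 1"
  by (simp add: circlepath)

text \<open>Cauchy's formula at the centre: the derivative of the circle path is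
  \<open>2 * pi * \<i>\<close> times the path, which cancels the kernel.\<close>

lemma circle_mean_value:
  assumes "g holomorphic_on cball 0 1"
  shows "((\<lambda>t. g (circlepath 0 1 t)) has_integral g 0) {0..1}"
proof -
  have "((\<lambda>u. g u / (u - 0)) has_contour_integral 2 * of_real pi * \<i> * g 0) (circlepath 0 1)"
    by (rule Cauchy_integral_circlepath_simple[OF assms]) simp
  then have "((\<lambda>t. g (circlepath 0 1 t) / circlepath 0 1 t *
      vector_derivative (circlepath 0 1) (at t within {0..1})) has_integral
      2 * of_real pi * \<i> * g 0) {0..1}"
    by (simp add: has_contour_integral_def)
  then have "((\<lambda>t. 2 * of_real pi * \<i> * g (circlepath 0 1 t)) has_integral
      2 * of_real pi * \<i> * g 0) {0..1}"
    by (rule has_integral_eq[rotated]) (simp add: vector_derivative_circlepath01, simp add: circlepath)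
  then have "((\<lambda>t. 1 / (2 * of_real pi * \<i>) * (2 * of_real pi * \<i> * g (circlepath 0 1 t)))
      has_integral 1 / (2 * of_real pi * \<i>) * (2 * of_real pi * \<i> * g 0)) {0..1}"
    by (rule has_integral_mult_right)
  then show ?thesis by simp
qed

lemma circlepath_power_mult_cnj:
  assumes "q \<le> p"
  shows "circlepath 0 1 t ^ p * cnj (circlepath 0 1 t ^ q) = circlepath 0 1 t ^ (p - q)"
proof -
  let ?e = "circlepath 0 1 t"
  have "?e ^ p * cnj (?e ^ q) = ?e ^ (p - q) * (?e ^ q * cnj (?e ^ q))"
    using assms by (simp flip: power_add mult.assoc)
  also have "?e ^ q * cnj (?e ^ q) = complex_of_real ((cmod (?e ^ q))\<^sup>2)"
    by (rule complex_norm_square[symmetric])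
  also have "\<dots> = 1" by (simp add: norm_circlepath_0_1 norm_power)
  finally show ?thesis by simp
qed

text \<open>For \<open>q \<le> p\<close> the product is the power \<open>p - q\<close>, whose mean
  is its value at 0; conjugation swaps the exponents.\<close>

lemma circle_power_orthonormal:
  "((\<lambda>t. circlepath 0 1 t ^ p * cnj (circlepath 0 1 t ^ q)) has_integral
    (if p = q then 1 else 0)) {0..1}"
proof -
  have *: "((\<lambda>t. circlepath 0 1 t ^ p * cnj (circlepath 0 1 t ^ q)) has_integral
    (if p = q then 1 else 0)) {0..1}" if "q \<le> p" for p q
  proof -
    have "((\<lambda>t. circlepath 0 1 t ^ (p - q)) has_integral 0 ^ (p - q)) {0..1}"
      by (rule circle_mean_value) (intro holomorphic_intros)
    then show ?thesis
      using that by (simp add: circlepath_power_mult_cnj power_0_left del: complex_cnj_power)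
  qed
  show ?thesis
  proof (cases "q \<le> p")
    case True
    then show ?thesis by (rule *)
  next
    case False
    then show ?thesis
      using *[of p q] has_integral_cnj[where I = 0 and A = "{0..1}"
          and f = "\<lambda>t. circlepath 0 1 t ^ q * cnj (circlepath 0 1 t ^ p)"]
      by (simp add: mult.commute o_def)
  qed
qed

text \<open>Expanding the square gives a double sum of which only the diagonal survives; the
  computation is complex and takes real parts at the end.\<close>

lemma circle_parseval:
  fixes a :: "nat \<Rightarrow> complex"
  shows "((\<lambda>t. (cmod (\<Sum>k\<le>N. circlepath 0 1 t ^ k * a k))\<^sup>2) has_integral
    (\<Sum>k\<le>N. (cmod (a k))\<^sup>2)) {0..1}"
proof -
  let ?e = "circlepath 0 1"
  have "((\<lambda>t. \<Sum>p\<le>N. \<Sum>q\<le>N. a p * cnj (a q) * (?e t ^ p * cnj (?e t ^ q))) has_integral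
      (\<Sum>p\<le>N. \<Sum>q\<le>N. a p * cnj (a q) * (if p = q then 1 else 0))) {0..1}"
    by (intro has_integral_sum has_integral_mult_right circle_power_orthonormal) auto
  moreover have "(\<Sum>p\<le>N. \<Sum>q\<le>N. a p * cnj (a q) * (if p = q then 1 else 0)) =
      complex_of_real (\<Sum>k\<le>N. (cmod (a k))\<^sup>2)"
    by (simp add: complex_norm_square if_distrib cong: if_cong del: of_real_power)
  moreover have "(\<Sum>p\<le>N. \<Sum>q\<le>N. a p * cnj (a q) * (?e t ^ p * cnj (?e t ^ q))) =
      complex_of_real ((cmod (\<Sum>k\<le>N. ?e t ^ k * a k))\<^sup>2)" for t
    unfolding complex_norm_square cnj_sum sum_product by (simp add: mult_ac)
  ultimately have "((\<lambda>t. complex_of_real ((cmod (\<Sum>k\<le>N. ?e t ^ k * a k))\<^sup>2)) has_integral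
      complex_of_real (\<Sum>k\<le>N. (cmod (a k))\<^sup>2)) {0..1}"
    by (simp only:)
  then have "((\<lambda>t. Re (complex_of_real ((cmod (\<Sum>k\<le>N. ?e t ^ k * a k))\<^sup>2))) has_integral
      Re (complex_of_real (\<Sum>k\<le>N. (cmod (a k))\<^sup>2))) {0..1}"
    by (rule has_integral_Re)
  then show ?thesis by (simp only: Re_complex_of_real)
qed

lemma circle_parseval_vec:
  fixes a :: "nat \<Rightarrow> complex^'n"
  shows "((\<lambda>t. (norm (\<Sum>k\<le>N. circlepath 0 1 t ^ k *s a k))\<^sup>2) has_integral
    (\<Sum>k\<le>N. (norm (a k))\<^sup>2)) {0..1}"
proof -
  have "((\<lambda>t. \<Sum>i\<in>UNIV. (cmod (\<Sum>k\<le>N. circlepath 0 1 t ^ k * a k $ i))\<^sup>2) has_integral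
    (\<Sum>i\<in>UNIV. \<Sum>k\<le>N. (cmod (a k $ i))\<^sup>2)) {0..1}"
    by (intro has_integral_sum circle_parseval) auto
  moreover have "(\<Sum>k\<le>N. (norm (a k))\<^sup>2) = (\<Sum>i\<in>UNIV. \<Sum>k\<le>N. (cmod (a k $ i))\<^sup>2)"
    unfolding norm_vec_power2 by (rule sum.swap)
  ultimately show ?thesis by (simp add: norm_vec_power2)
qed

text \<open>On the unit circle, the conjugate of a polynomial of degree \<open>\<le> N\<close> times \<open>w\<^sup>N\<^sup>+\<^sup>1 Q\<close> is again
  holomorphic and vanishes at \<open>0\<close>.\<close>

lemma circle_cross_term:
  fixes a :: "nat \<Rightarrow> complex"
  assumes "Q holomorphic_on cball 0 1"
  shows "((\<lambda>t. cnj (\<Sum>k\<le>N. circlepath 0 1 t ^ k * a k) *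
    (circlepath 0 1 t ^ Suc N * Q (circlepath 0 1 t))) has_integral 0) {0..1}"
proof -
  let ?g = "\<lambda>w. \<Sum>k\<le>N. cnj (a k) * (w ^ (Suc N - k) * Q w)"
  have "((\<lambda>t. ?g (circlepath 0 1 t)) has_integral ?g 0) {0..1}"
    by (rule circle_mean_value) (intro holomorphic_intros assms)
  moreover have "?g 0 = 0" by (intro sum.neutral) auto
  moreover have "?g (circlepath 0 1 t) = cnj (\<Sum>k\<le>N. circlepath 0 1 t ^ k * a k) *
      (circlepath 0 1 t ^ Suc N * Q (circlepath 0 1 t))" for t
    unfolding cnj_sum sum_distrib_right
  proof (intro sum.cong refl)
    fix k assume "k \<in> {..N}"
    then have "circlepath 0 1 t ^ (Suc N - k) = circlepath 0 1 t ^ Suc N * cnj (circlepath 0 1 t ^ k)"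
      by (intro circlepath_power_mult_cnj[symmetric]) simp
    then show "cnj (a k) * (circlepath 0 1 t ^ (Suc N - k) * Q (circlepath 0 1 t)) =
        cnj (circlepath 0 1 t ^ k * a k) * (circlepath 0 1 t ^ Suc N * Q (circlepath 0 1 t))"
      by (simp only: complex_cnj_mult mult_ac)
  qed
  ultimately show ?thesis by (simp only:)
qed

text \<open>Multiplying the scheme by \<open>w ^ k\<close> and summing turns the backward difference
  quotient into the factor \<open>(1 - w) / h\<close>; truncation at \<open>N\<close> leaves the
  term with \<open>y N\<close>. Since \<open>0 - 1 = 0\<close> on naturals,
  \<open>f 0 = - M *v y 0 = 0\<close>.\<close>

lemma implicit_euler_generating_function:
  fixes M :: "complex^'n^'n" and y f :: "nat \<Rightarrow> complex^'n"
  assumes "y 0 = 0"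
    and f: "\<And>k. f k = (1 / h) *\<^sub>R (y k - y (k - 1)) - M *v y k"
  shows "((1 - w) / of_real h) *s (\<Sum>k\<le>N. w ^ k *s y k) - M *v (\<Sum>k\<le>N. w ^ k *s y k)
    + w ^ Suc N *s ((1 / h) *\<^sub>R y N) = (\<Sum>k\<le>N. w ^ k *s f k)"
proof (induction N)
  case 0
  then show ?case by (simp add: assms(1) f)
next
  case (Suc N)
  have step: "((1 - w) / of_real h) *s (w ^ Suc N *s y (Suc N)) - M *v (w ^ Suc N *s y (Suc N))
      + w ^ Suc (Suc N) *s ((1 / h) *\<^sub>R y (Suc N))
    = w ^ Suc N *s ((1 / h) *\<^sub>R y N) + w ^ Suc N *s f (Suc N)"
    by (simp add: f vec_eq_iff vector_scalar_commute scaleR_conv_of_real[where 'a = complex]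
        algebra_simps diff_divide_distrib)
  let ?c = "(1 - w) / complex_of_real h"
  let ?S = "\<Sum>k\<le>N. w ^ k *s y k"
  have "?c *s (\<Sum>k\<le>Suc N. w ^ k *s y k) - M *v (\<Sum>k\<le>Suc N. w ^ k *s y k)
      + w ^ Suc (Suc N) *s ((1 / h) *\<^sub>R y (Suc N))
    = (?c *s ?S - M *v ?S) + (?c *s (w ^ Suc N *s y (Suc N)) - M *v (w ^ Suc N *s y (Suc N))
      + w ^ Suc (Suc N) *s ((1 / h) *\<^sub>R y (Suc N)))"
    unfolding sum.atMost_Suc vec.scale_right_distrib matrix_vector_right_distrib by simp
  also have "\<dots> = (?c *s ?S - M *v ?S + w ^ Suc N *s ((1 / h) *\<^sub>R y N)) + w ^ Suc N *s f (Suc N)"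
    unfolding step by simp
  finally show ?case unfolding Suc.IH by simp
qed

text \<open>The step \<open>w \<mapsto> (1 - w) / h\<close> of the implicit Euler scheme maps the closed unit disc into the
  closed right half-plane, where the resolvent is bounded. The correction \<open>w\<^sup>N\<^sup>+\<^sup>1 Q(w)\<close> continues the
  scheme with zero inhomogeneity after time \<open>N\<close>; it does not interfere in the mean over the circle.\<close>

lemma implicit_euler_l2_bound:
  fixes M :: "complex^'n^'n" and y f :: "nat \<Rightarrow> complex^'n"
  assumes M: "resolvent_bounded \<epsilon> M" and \<epsilon>: "0 < \<epsilon>" and h: "0 < h"
    and y0: "y 0 = 0"
    and f: "\<And>k. f k = (1 / h) *\<^sub>R (y k - y (k - 1)) - M *v y k"
  shows "\<epsilon>\<^sup>2 * (\<Sum>k\<le>N. (norm (y k))\<^sup>2) \<le> (\<Sum>k\<le>N. (norm (f k))\<^sup>2)"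
proof -
  define c where "c w = (1 - w) / complex_of_real h" for w
  let ?e = "circlepath 0 1"
  have bound: "\<epsilon> * norm v \<le> norm (c w *s v - M *v v)" if "w \<in> cball 0 1" for w v
  proof (rule resolvent_bounded_closed_half_plane[OF M])
    show "0 \<le> Re (c w)"
      using that h complex_Re_le_cmod[of w] by (simp add: c_def)
  qed
  have inj: "c w *s v - M *v v \<noteq> 0" if "w \<in> cball 0 1" "v \<noteq> 0" for w v
  proof -
    have "0 < \<epsilon> * norm v" using \<epsilon> that by simp
    then show ?thesis using bound[OF that(1), of v] by auto
  qed
  have c: "c holomorphic_on cball 0 1"
    unfolding c_def using h by (intro holomorphic_intros) auto
  \<comment> \<open>The truncation term of the generating function is the right-hand side for
    \<open>Q\<close>, so that \<open>P w + w ^ Suc N *s Q w\<close> solves the resolvent equation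
    with exactly the polynomial in \<open>f\<close> on the right.\<close>
  obtain Q where hol: "\<And>i. (\<lambda>w. Q w $ i) holomorphic_on cball 0 1"
    and Q: "\<And>w. w \<in> cball 0 1 \<Longrightarrow> c w *s Q w - M *v Q w = (1 / h) *\<^sub>R y N"
    using resolvent_holomorphic[OF c inj, where b = "(1 / h) *\<^sub>R y N"] by blast
  define P where "P w = (\<Sum>k\<le>N. w ^ k *s y k)" for w
  \<comment> \<open>The inner product of \<open>P\<close> with the correction, that is, the cross
    term in the squared norm of their sum.\<close>
  define X where "X t = (\<Sum>i\<in>UNIV. cnj (P (?e t) $ i) * (?e t ^ Suc N * Q (?e t) $ i))" for t
  have P_nth: "P w $ i = (\<Sum>k\<le>N. w ^ k * y k $ i)" for w i
    by (simp add: P_def)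
  have "(X has_integral 0) {0..1}"
  proof -
    have "(X has_integral (\<Sum>i\<in>(UNIV::'n set). 0)) {0..1}"
      unfolding X_def P_nth by (intro has_integral_sum circle_cross_term hol) auto
    then show ?thesis by simp
  qed
  then have X: "((\<lambda>t. Re (X t)) has_integral 0) {0..1}"
    using has_integral_Re[of X 0] by simp
  have "((\<lambda>t. \<epsilon>\<^sup>2 * ((norm (P (?e t)))\<^sup>2 + 2 * Re (X t))) has_integral
      \<epsilon>\<^sup>2 * ((\<Sum>k\<le>N. (norm (y k))\<^sup>2) + 2 * 0)) {0..1}"
    unfolding P_def by (intro has_integral_mult_right has_integral_add circle_parseval_vec X)
  moreover have "((\<lambda>t. (norm (\<Sum>k\<le>N. ?e t ^ k *s f k))\<^sup>2) has_integral
      (\<Sum>k\<le>N. (norm (f k))\<^sup>2)) {0..1}"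
    by (rule circle_parseval_vec)
  moreover have "\<epsilon>\<^sup>2 * ((norm (P (?e t)))\<^sup>2 + 2 * Re (X t)) \<le> (norm (\<Sum>k\<le>N. ?e t ^ k *s f k))\<^sup>2" for t
  proof -
    define w where "w = ?e t"
    define Y where "Y = P w + w ^ Suc N *s Q w"
    have w: "w \<in> cball 0 1" by (simp add: w_def norm_circlepath_0_1)
    have "c w *s Y - M *v Y = (c w *s P w - M *v P w) + w ^ Suc N *s (c w *s Q w - M *v Q w)"
      by (simp add: Y_def vec.scale_right_distrib vec.scale_right_diff_distrib matrix_vector_right_distrib
          vector_scalar_commute vector_smult_assoc mult.commute del: power_Suc)
    also have "\<dots> = (\<Sum>k\<le>N. w ^ k *s f k)"
      using implicit_euler_generating_function[OF y0 f] Q[OF w] by (simp add: c_def P_def)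
    finally have Y: "c w *s Y - M *v Y = (\<Sum>k\<le>N. w ^ k *s f k)" .
    \<comment> \<open>Expand componentwise and drop the square of the correction.\<close>
    have "(norm (P w))\<^sup>2 + 2 * Re (X t) \<le> (norm Y)\<^sup>2"
    proof -
      have "(cmod (p + q))\<^sup>2 = (cmod p)\<^sup>2 + 2 * Re (cnj p * q) + (cmod q)\<^sup>2" for p q
        by (simp add: cmod_power2) (simp add: power2_eq_square algebra_simps)
      then show ?thesis
        unfolding norm_vec_power2 X_def Re_sum sum_distrib_left sum.distrib[symmetric] w_def[symmetric]
        by (intro sum_mono) (simp add: Y_def del: power_Suc)
    qed
    then have "\<epsilon>\<^sup>2 * ((norm (P w))\<^sup>2 + 2 * Re (X t)) \<le> \<epsilon>\<^sup>2 * (norm Y)\<^sup>2"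
      by (simp add: mult_left_mono)
    also have "\<dots> = (\<epsilon> * norm Y)\<^sup>2" by (simp add: power_mult_distrib)
    also have "\<dots> \<le> (norm (\<Sum>k\<le>N. w ^ k *s f k))\<^sup>2"
      using bound[OF w, of Y] \<epsilon> unfolding Y by (intro power_mono) auto
    finally show ?thesis by (simp only: w_def)
  qed
  ultimately have "\<epsilon>\<^sup>2 * ((\<Sum>k\<le>N. (norm (y k))\<^sup>2) + 2 * 0) \<le> (\<Sum>k\<le>N. (norm (f k))\<^sup>2)"
    by (rule has_integral_le)
  then show ?thesis by simp
qed

section \<open>Absolutely continuous functions\<close>

lemma abs_continuous_between_subset:
  assumes "abs_continuous_between a b y" "a \<le> a'" "b' \<le> b"
  shows "abs_continuous_between a' b' y"
  unfolding abs_continuous_between_def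
proof (intro allI impI)
  fix e :: real assume "e > 0"
  then obtain d where "d > 0" and d: "\<forall>I. finite I \<and> (\<forall>(u, v)\<in>I. a \<le> u \<and> u \<le> v \<and> v \<le> b) \<and>
       pairwise (\<lambda>(u, v) (u', v'). {u<..<v} \<inter> {u'<..<v'} = {}) I \<and>
       (\<Sum>(u, v)\<in>I. v - u) < d \<longrightarrow> (\<Sum>(u, v)\<in>I. norm (y v - y u)) < e"
    using assms(1) unfolding abs_continuous_between_def by meson
  show "\<exists>d>0. \<forall>I. finite I \<and> (\<forall>(u, v)\<in>I. a' \<le> u \<and> u \<le> v \<and> v \<le> b') \<and>
       pairwise (\<lambda>(u, v) (u', v'). {u<..<v} \<inter> {u'<..<v'} = {}) I \<and>
       (\<Sum>(u, v)\<in>I. v - u) < d \<longrightarrow> (\<Sum>(u, v)\<in>I. norm (y v - y u)) < e"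
  proof (intro exI conjI allI impI)
    fix I assume I: "finite I \<and> (\<forall>(u, v)\<in>I. a' \<le> u \<and> u \<le> v \<and> v \<le> b') \<and>
       pairwise (\<lambda>(u, v) (u', v'). {u<..<v} \<inter> {u'<..<v'} = {}) I \<and> (\<Sum>(u, v)\<in>I. v - u) < d"
    then have "\<forall>(u, v)\<in>I. a \<le> u \<and> u \<le> v \<and> v \<le> b"
      using assms(2,3) by fastforce
    then show "(\<Sum>(u, v)\<in>I. norm (y v - y u)) < e" using I by (intro d[THEN spec, THEN mp]) simp
  qed (rule \<open>d > 0\<close>)
qed

lemma abs_continuous_between_imp_continuous_on:
  assumes "abs_continuous_between a b y"
  shows "continuous_on {a..b} y"
  unfolding continuous_on_iff
proof (intro ballI allI impI)
  fix s e :: real assume s: "s \<in> {a..b}" and "e > 0"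
  then obtain d where "d > 0" and d: "\<forall>I. finite I \<and> (\<forall>(u, v)\<in>I. a \<le> u \<and> u \<le> v \<and> v \<le> b) \<and>
       pairwise (\<lambda>(u, v) (u', v'). {u<..<v} \<inter> {u'<..<v'} = {}) I \<and>
       (\<Sum>(u, v)\<in>I. v - u) < d \<longrightarrow> (\<Sum>(u, v)\<in>I. norm (y v - y u)) < e"
    using assms unfolding abs_continuous_between_def by meson
  have "dist (y t) (y s) < e" if "t \<in> {a..b}" "dist t s < d" for t
    using d[THEN spec, of "{(s, t)}"] d[THEN spec, of "{(t, s)}"] s that
    by (cases "s \<le> t") (auto simp: dist_norm norm_minus_commute)
  then show "\<exists>d>0. \<forall>t\<in>{a..b}. dist t s < d \<longrightarrow> dist (y t) (y s) < e"
    using \<open>d > 0\<close> by blast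
qed

text \<open>Absolute continuity is about sets of endpoint pairs, so the tagged intervals are
  projected to their endpoints. Disjoint interiors make the total length the measure of a union
  inside \<open>T\<close>, hence less than \<open>d\<close>.\<close>

lemma tagged_partial_division_abs_continuous:
  assumes d: "\<And>I. finite I \<and> (\<forall>(u, v)\<in>I. a \<le> u \<and> u \<le> v \<and> v \<le> b) \<and>
       pairwise (\<lambda>(u, v) (u', v'). {u<..<v} \<inter> {u'<..<v'} = {}) I \<and>
       (\<Sum>(u, v)\<in>I. v - u) < d \<Longrightarrow> (\<Sum>(u, v)\<in>I. norm (y v - y u)) < (e::real)"
    and p: "p tagged_partial_division_of {a..b}"
    and T: "\<And>x K. (x, K) \<in> p \<Longrightarrow> K \<subseteq> T" "T \<in> sets lebesgue" "emeasure lebesgue T < ennreal d"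
  shows "(\<Sum>(x, K)\<in>p. norm (y (Sup K) - y (Inf K))) < e"
proof -
  \<comment> \<open>The projection is shown injective from disjoint nonempty interiors, so
    degenerate intervals are set aside; their increments are zero.\<close>
  define p' where "p' = {(x, K) \<in> p. Inf K < Sup K}"
  define e2 where "e2 = (\<lambda>(x::real, K::real set). (Inf K, Sup K))"
  have fin: "finite p" using p by (rule tagged_partial_division_ofD)
  have cbox: "x \<in> {Inf K..Sup K} \<and> K = {Inf K..Sup K} \<and> a \<le> Inf K \<and> Sup K \<le> b \<and> Inf K \<le> Sup K"
    if xK: "(x, K) \<in> p" for x K
  proof -
    obtain u v where "K = {u..v}" "x \<in> K" "K \<subseteq> {a..b}"
      using tagged_partial_division_ofD[OF p] xK by (metis box_real(2))
    then show ?thesis by auto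
  qed
  have int: "interior K = {Inf K<..<Sup K}" if "(x, K) \<in> p" for x K
    using cbox[OF that] by (metis interior_atLeastAtMost_real)
  have disj: "{Inf K<..<Sup K} \<inter> {Inf K'<..<Sup K'} = {}"
    if "(x, K) \<in> p" "(x', K') \<in> p" "(x, K) \<noteq> (x', K')" for x K x' K'
    using tagged_partial_division_ofD(5)[OF p that] int that by simp
  have inj: "inj_on e2 p'"
  proof (rule inj_onI, clarify)
    fix x K x' K' assume *: "(x, K) \<in> p'" "(x', K') \<in> p'" "e2 (x, K) = e2 (x', K')"
    show "x = x' \<and> K = K'"
      using disj[of x K x' K'] * by (auto simp: p'_def e2_def)
  qed
  define I where "I = e2 ` p'"
  have "finite p'" by (rule finite_subset[OF _ fin]) (auto simp: p'_def)
  then have finI: "finite I" by (simp add: I_def)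
  have bnd: "\<forall>(u, v)\<in>I. a \<le> u \<and> u \<le> v \<and> v \<le> b"
    using cbox by (auto simp: I_def p'_def e2_def)
  have pw: "pairwise (\<lambda>(u, v) (u', v'). {u<..<v} \<inter> {u'<..<v'} = {}) I"
    unfolding pairwise_def
  proof (intro ballI impI)
    fix i j assume "i \<in> I" "j \<in> I" and ne: "i \<noteq> j"
    then obtain x K x' K' where "(x, K) \<in> p" "(x', K') \<in> p"
      and ij: "i = (Inf K, Sup K)" "j = (Inf K', Sup K')"
      by (auto simp: I_def p'_def e2_def)
    then have "{Inf K<..<Sup K} \<inter> {Inf K'<..<Sup K'} = {}" using ne by (intro disj) auto
    then show "(case i of (u, v) \<Rightarrow> \<lambda>(u', v'). {u<..<v} \<inter> {u'<..<v'} = {}) j" by (simp add: ij)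
  qed
  have sub: "{u<..<v} \<subseteq> T" if uv: "(u, v) \<in> I" for u v
  proof -
    obtain x K where K: "(x, K) \<in> p" "u = Inf K" "v = Sup K"
      using uv by (auto simp: I_def p'_def e2_def)
    then have "{u<..<v} \<subseteq> K" using cbox[OF K(1)] by (metis greaterThanLessThan_subseteq_atLeastAtMost_iff order_refl)
    then show ?thesis using T(1)[OF K(1)] by blast
  qed
  have "ennreal (\<Sum>(u, v)\<in>I. v - u) = (\<Sum>(u, v)\<in>I. ennreal (v - u))"
    using bnd by (subst sum_ennreal[symmetric]) (auto simp: split_def)
  also have "\<dots> = (\<Sum>i\<in>I. emeasure lebesgue ((\<lambda>(u, v). {u<..<v}) i))"
    using bnd by (intro sum.cong) auto
  also have "\<dots> = emeasure lebesgue (\<Union>i\<in>I. (\<lambda>(u, v). {u<..<v}) i)"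
    using pw finI by (intro sum_emeasure) (auto simp: disjoint_family_on_def pairwise_def split_def)
  also have "\<dots> \<le> emeasure lebesgue T"
    using sub T(2) by (intro emeasure_mono) (auto simp: split_def subset_iff)
  also have "\<dots> < ennreal d" by (rule T(3))
  finally have "(\<Sum>(u, v)\<in>I. v - u) < d"
    using bnd by (subst (asm) ennreal_less_iff) (auto intro!: sum_nonneg)
  then have "(\<Sum>(u, v)\<in>I. norm (y v - y u)) < e"
    using finI bnd pw by (intro d) simp
  moreover have "(\<Sum>(u, v)\<in>I. norm (y v - y u)) = (\<Sum>(x, K)\<in>p'. norm (y (Sup K) - y (Inf K)))"
    unfolding I_def sum.reindex[OF inj] by (rule sum.cong) (auto simp: e2_def)
  moreover have "\<dots> = (\<Sum>(x, K)\<in>p. norm (y (Sup K) - y (Inf K)))"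
    using fin
  proof (intro sum.mono_neutral_left ballI)
    fix i assume i: "i \<in> p - p'"
    obtain x K where xK: "i = (x, K)" by (cases i)
    then have "Inf K = Sup K" using i cbox[of x K] by (auto simp: p'_def)
    then show "(case i of (x, K) \<Rightarrow> norm (y (Sup K) - y (Inf K))) = 0" by (simp add: xK)
  qed (auto simp: p'_def)
  ultimately show ?thesis by simp
qed

text \<open>The gauge is an open set of small measure at the tags where the derivative fails; there
  absolute continuity bounds the increments.\<close>

lemma fundamental_theorem_of_calculus_abs_continuous:
  fixes y g :: "real \<Rightarrow> 'a::banach"
  assumes "a \<le> b" and ac: "abs_continuous_between a b y" and N: "negligible N"
    and deriv: "\<And>t. t \<in> {a..b} - N \<Longrightarrow> (y has_vector_derivative g t) (at t within {a..b})"
  shows "(g has_integral (y b - y a)) {a..b}"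
proof -
  \<comment> \<open>With the integrand zero on \<open>N\<close>, tags in \<open>N\<close> contribute
    only increments of \<open>y\<close>. The change on a null set is undone at the end.\<close>
  define g' where "g' t = (if t \<in> N then 0 else g t)" for t
  have "(g' has_integral (y b - y a)) {a..b}"
    unfolding has_integral_real
  proof (intro allI impI)
    fix e :: real assume "e > 0"
    then have "e / 2 > 0" by simp
    then obtain d where "d > 0" and d: "\<forall>I. finite I \<and> (\<forall>(u, v)\<in>I. a \<le> u \<and> u \<le> v \<and> v \<le> b) \<and>
         pairwise (\<lambda>(u, v) (u', v'). {u<..<v} \<inter> {u'<..<v'} = {}) I \<and>
         (\<Sum>(u, v)\<in>I. v - u) < d \<longrightarrow> (\<Sum>(u, v)\<in>I. norm (y v - y u)) < e / 2"
      using ac unfolding abs_continuous_between_def by meson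
    \<comment> \<open>The summand 1 keeps the denominator positive when
      \<open>a = b\<close>.\<close>
    define e2 where "e2 = e / (2 * (b - a + 1))"
    have "e2 > 0" using \<open>e > 0\<close> \<open>a \<le> b\<close> by (simp add: e2_def)
    have e2: "e2 * (b - a) \<le> e / 2"
      using \<open>e > 0\<close> \<open>a \<le> b\<close> by (simp add: e2_def field_simps)
    have Nnull: "N \<in> null_sets lebesgue" using N by (simp add: negligible_iff_null_sets)
    obtain T where T: "open T" "N \<subseteq> T" "emeasure lebesgue (T - N) < ennreal d"
      by (rule sets_lebesgue_outer_open[OF null_setsD2[OF Nnull] \<open>d > 0\<close>])
    have Tm: "T \<in> sets lebesgue" using T(1) by simp
    have T_d: "emeasure lebesgue T < ennreal d"
      using T(3) emeasure_Diff_null_set[OF Nnull Tm] by simp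
    have "\<exists>r>0. t \<in> {a..b} - N \<longrightarrow> (\<forall>s\<in>{a..b}. norm (s - t) < r \<longrightarrow>
        norm (y s - y t - (s - t) *\<^sub>R g t) \<le> e2 * norm (s - t))" for t
    proof (cases "t \<in> {a..b} - N")
      case True
      then show ?thesis
        using deriv[OF True] \<open>e2 > 0\<close> unfolding has_vector_derivative_def has_derivative_within_alt by blast
    next
      case False
      then show ?thesis by (intro exI[of _ 1] conjI impI) (simp, blast)
    qed
    then obtain r where r0: "\<And>t. r t > 0" and r: "\<And>t s. t \<in> {a..b} - N \<Longrightarrow> s \<in> {a..b} \<Longrightarrow>
        norm (s - t) < r t \<Longrightarrow> norm (y s - y t - (s - t) *\<^sub>R g t) \<le> e2 * norm (s - t)"
      by metis
    define \<gamma> where "\<gamma> t = (if t \<in> N then T else ball t (r t))" for t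
    have "gauge \<gamma>" using T r0 by (auto simp: gauge_def \<gamma>_def)
    moreover have "norm ((\<Sum>(x, K)\<in>p. measure lborel K *\<^sub>R g' x) - (y b - y a)) < e"
      if p: "p tagged_division_of {a..b}" and fine: "\<gamma> fine p" for p
    proof -
      define D where "D = (\<lambda>(x, K). measure lborel K *\<^sub>R g' x - (y (Sup K) - y (Inf K)))"
      define p1 where "p1 = {(x, K) \<in> p. x \<in> N}"
      define p2 where "p2 = {(x, K) \<in> p. x \<notin> N}"
      have fin: "finite p" using p by blast
      have p12: "p = p1 \<union> p2" "p1 \<inter> p2 = {}" by (auto simp: p1_def p2_def)
      have cbox: "\<exists>u v. u \<le> v \<and> K = {u..v} \<and> x \<in> K \<and> K \<subseteq> {a..b}" if xK: "(x, K) \<in> p" for x K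
      proof -
        have "x \<in> K" "K \<subseteq> {a..b}" "\<exists>u v. K = cbox u v"
          using tagged_division_ofD[OF p] xK by blast+
        then show ?thesis by fastforce
      qed
      have "(\<Sum>(x, K)\<in>p. measure lborel K *\<^sub>R g' x) - (y b - y a) = sum D p"
        unfolding additive_tagged_division_1[OF \<open>a \<le> b\<close> p, of y, symmetric] D_def
        by (simp add: sum_subtractf split_def)
      also have "\<dots> = sum D p1 + sum D p2"
        using fin p12 by (metis finite_Un sum.union_disjoint)
      finally have split: "norm ((\<Sum>(x, K)\<in>p. measure lborel K *\<^sub>R g' x) - (y b - y a)) \<le>
          norm (sum D p1) + norm (sum D p2)"
        by (simp add: norm_triangle_ineq)
      have "norm (sum D p1) \<le> (\<Sum>(x, K)\<in>p1. norm (y (Sup K) - y (Inf K)))"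
        by (rule sum_norm_le) (auto simp: p1_def D_def g'_def norm_minus_commute)
      also have "\<dots> < e / 2"
      proof (rule tagged_partial_division_abs_continuous[OF d[THEN spec, THEN mp]])
        show "p1 tagged_partial_division_of {a..b}"
          using p unfolding tagged_division_of_def
          by (auto elim: tagged_partial_division_subset simp: p1_def)
        show "K \<subseteq> T" if "(x, K) \<in> p1" for x K
        proof -
          have "(x, K) \<in> p" "x \<in> N" using that by (auto simp: p1_def)
          then show ?thesis using fineD[OF fine, of x K] by (simp add: \<gamma>_def)
        qed
      qed (use Tm T_d in auto)
      finally have 1: "norm (sum D p1) < e / 2" .
      have "norm (sum D p2) \<le> (\<Sum>(x, K)\<in>p2. e2 * (Sup K - Inf K))"
      proof (rule sum_norm_le, clarify)
        fix x K assume "(x, K) \<in> p2"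
        then have xK: "(x, K) \<in> p" and x: "x \<notin> N" by (auto simp: p2_def)
        then obtain u v where uv: "u \<le> v" and K: "K = {u..v}" and xuv: "x \<in> {u..v}" and sub: "{u..v} \<subseteq> {a..b}"
          using cbox by blast
        have "K \<subseteq> ball x (r x)" using fineD[OF fine xK] x by (simp add: \<gamma>_def)
        then have near: "norm (u - x) < r x" "norm (v - x) < r x"
          using uv by (auto simp: K subset_iff dist_real_def abs_minus_commute)
        \<comment> \<open>Straddle estimate: the increment over \<open>K\<close> is split at the
          tag, where the derivative controls both halves.\<close>
        have D: "D (x, K) = (y u - y x - (u - x) *\<^sub>R g x) - (y v - y x - (v - x) *\<^sub>R g x)"
          using uv x by (simp add: D_def K g'_def algebra_simps)
        have "norm (D (x, K)) \<le> norm (y u - y x - (u - x) *\<^sub>R g x) + norm (y v - y x - (v - x) *\<^sub>R g x)"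
          unfolding D by (rule norm_triangle_ineq4)
        also have "\<dots> \<le> e2 * norm (u - x) + e2 * norm (v - x)"
          using near x xuv sub uv by (intro add_mono r) auto
        also have "\<dots> = e2 * (v - u)" using xuv by (simp add: algebra_simps)
        finally show "norm (D (x, K)) \<le> e2 * (Sup K - Inf K)"
          using uv by (simp add: K)
      qed
      also have "\<dots> \<le> (\<Sum>(x, K)\<in>p. e2 * (Sup K - Inf K))"
      proof (rule sum_mono2[OF fin])
        show "p2 \<subseteq> p" by (auto simp: p2_def)
        fix i assume i: "i \<in> p - p2"
        obtain x K where xK: "i = (x, K)" by (cases i)
        then obtain u v where "u \<le> v" "K = {u..v}" using i cbox[of x K] by blast
        then show "0 \<le> (case i of (x, K) \<Rightarrow> e2 * (Sup K - Inf K))"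
          using \<open>e2 > 0\<close> by (simp add: xK)
      qed
      also have "\<dots> = e2 * (b - a)"
        using additive_tagged_division_1[OF \<open>a \<le> b\<close> p, of "\<lambda>x. x"]
        by (simp add: split_def flip: sum_distrib_left)
      finally have 2: "norm (sum D p2) \<le> e / 2" using e2 by linarith
      show ?thesis using split 1 2 by linarith
    qed
    ultimately show "\<exists>\<gamma>. gauge \<gamma> \<and> (\<forall>p. p tagged_division_of {a..b} \<and> \<gamma> fine p \<longrightarrow>
        norm ((\<Sum>(x, K)\<in>p. measure lborel K *\<^sub>R g' x) - (y b - y a)) < e)"
      by (intro exI[of _ \<gamma>] conjI allI impI) simp_all
  qed
  then show ?thesis
    by (rule has_integral_spike[OF N, rotated]) (simp add: g'_def)
qed

section \<open>The \<open>L\<^sup>2\<close> estimate\<close>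

text \<open>Cauchy-Schwarz: for the mean value \<open>w\<close> of \<open>F\<close>, the integral of
  \<open>(norm (F t - w))\<^sup>2\<close> is nonnegative and equals
  \<open>Q - (norm I)\<^sup>2 / (b - a)\<close>.\<close>

lemma norm_integral_power2_le:
  fixes F :: "real \<Rightarrow> 'a::euclidean_space"
  assumes "a < b" and F: "(F has_integral I) {a..b}"
    and Q: "((\<lambda>t. (norm (F t))\<^sup>2) has_integral Q) {a..b}"
  shows "(norm I)\<^sup>2 \<le> (b - a) * Q"
proof -
  define h where "h = b - a"
  have h: "h > 0" using \<open>a < b\<close> by (simp add: h_def)
  define w where "w = (1 / h) *\<^sub>R I"
  have "((\<lambda>t. w \<bullet> F t) has_integral w \<bullet> I) {a..b}"
    using has_integral_linear[OF F bounded_linear_inner_right] by (simp add: o_def)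
  moreover have "((\<lambda>t. w \<bullet> w) has_integral h * (w \<bullet> w)) {a..b}"
    using has_integral_const_real[of "w \<bullet> w" a b] h by (simp add: h_def)
  ultimately have "((\<lambda>t. (norm (F t))\<^sup>2 - 2 * (w \<bullet> F t) + w \<bullet> w) has_integral
      Q - 2 * (w \<bullet> I) + h * (w \<bullet> w)) {a..b}"
    by (intro has_integral_add has_integral_diff Q has_integral_mult_right)
  moreover have "(norm (F t))\<^sup>2 - 2 * (w \<bullet> F t) + w \<bullet> w = (norm (F t - w))\<^sup>2" for t
    by (simp add: power2_norm_eq_inner inner_diff inner_commute algebra_simps)
  ultimately have "((\<lambda>t. (norm (F t - w))\<^sup>2) has_integral Q - 2 * (w \<bullet> I) + h * (w \<bullet> w)) {a..b}"
    by (simp only:)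
  then have "0 \<le> Q - 2 * (w \<bullet> I) + h * (w \<bullet> w)"
    by (rule has_integral_nonneg) simp
  moreover have "w \<bullet> I = (norm I)\<^sup>2 / h" "h * (w \<bullet> w) = (norm I)\<^sup>2 / h"
    using h by (simp_all add: w_def power2_norm_eq_inner)
  ultimately have "(norm I)\<^sup>2 / h \<le> Q" by simp
  then show ?thesis using h by (simp add: h_def field_simps)
qed

lemma has_integral_uniform_grid:
  fixes F :: "real \<Rightarrow> 'a::banach"
  assumes "0 \<le> h" and "\<And>k. k < N \<Longrightarrow> (F has_integral I k) {real k * h..real (Suc k) * h}"
  shows "(F has_integral (\<Sum>k<N. I k)) {0..real N * h}"
  using assms(2)
proof (induction N)
  case 0
  then show ?case using has_integral_refl(2)[of F "0::real"] by simp
next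
  case (Suc N)
  show ?case unfolding sum.lessThan_Suc
  proof (rule has_integral_combine)
    show "(F has_integral (\<Sum>k<N. I k)) {0..real N * h}" by (rule Suc.IH, rule Suc.prems) simp
    show "(F has_integral I N) {real N * h..real (Suc N) * h}" by (rule Suc.prems) simp
  qed (use assms(1) in \<open>auto simp: mult_right_mono\<close>)
qed

text \<open>Young's inequality. For small \<open>\<eta>\<close> the main term \<open>a\<close> keeps
  a factor close to 1, and the error \<open>b\<close> bears the large one.\<close>

lemma power2_sum_le_weighted:
  fixes a b \<eta> :: real
  assumes "\<eta> > 0"
  shows "(a + b)\<^sup>2 \<le> (1 + \<eta>) * a\<^sup>2 + (1 + 1 / \<eta>) * b\<^sup>2"
proof -
  have "0 \<le> (\<eta> * a - b)\<^sup>2 / \<eta>" using assms by simp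
  also have "\<dots> = \<eta> * a\<^sup>2 - 2 * a * b + b\<^sup>2 / \<eta>"
    using assms by (simp add: power2_eq_square field_simps)
  finally show ?thesis by (simp add: power2_eq_square algebra_simps)
qed

lemma norm_power2_le_weighted:
  assumes "\<eta> > 0" and "norm v \<le> a + b"
  shows "(norm v)\<^sup>2 \<le> (1 + \<eta>) * a\<^sup>2 + (1 + 1 / \<eta>) * b\<^sup>2"
  using power_mono[OF assms(2), of 2] power2_sum_le_weighted[OF assms(1), of a b] by simp

text \<open>Here \<open>\<delta>\<close> bounds the oscillation of \<open>y\<close> within a grid
  cell and \<open>\<eta>\<close> is the weight separating main terms from errors. The grid is chosen
  inside the proof, so its step size does not enter the estimate.\<close>

lemma sampled_l2_bound:
  fixes M :: "complex^'n^'n" and y f :: "real \<Rightarrow> complex^'n"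
  assumes M: "resolvent_bounded \<epsilon> M" and \<epsilon>: "0 < \<epsilon>" and T: "0 < T" and y0: "y 0 = 0"
    and cont: "continuous_on {0..T} y"
    and ftc: "\<And>a b. 0 \<le> a \<Longrightarrow> a \<le> b \<Longrightarrow> b \<le> T \<Longrightarrow>
      ((\<lambda>t. M *v y t + f t) has_integral (y b - y a)) {a..b}"
    and Q: "((\<lambda>t. (norm (f t))\<^sup>2) has_integral Q) {0..T}"
    and J: "((\<lambda>t. (norm (y t))\<^sup>2) has_integral J) {0..T}"
    and \<delta>: "0 < \<delta>" and \<eta>: "0 < \<eta>"
  shows "\<epsilon>\<^sup>2 * J \<le> (1 + \<eta>) * ((1 + \<eta>) * Q + (1 + 1 / \<eta>) * (T * (norm M * \<delta>)\<^sup>2))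
    + \<epsilon>\<^sup>2 * ((1 + 1 / \<eta>) * (T * \<delta>\<^sup>2))"
proof -
  have "uniformly_continuous_on {0..T} y"
    by (rule compact_uniformly_continuous[OF cont]) simp
  then obtain d where "d > 0"
    and "\<forall>t\<in>{0..T}. \<forall>s\<in>{0..T}. dist s t < d \<longrightarrow> dist (y s) (y t) < \<delta>"
    using \<delta> unfolding uniformly_continuous_on_def by meson
  then have d: "norm (y s - y t) < \<delta>" if "s \<in> {0..T}" "t \<in> {0..T}" "\<bar>s - t\<bar> < d" for s t
    using that by (simp add: dist_norm)
  obtain N :: nat where N: "T / d < real N" using reals_Archimedean2 by blast
  have "0 < T / d" using T \<open>d > 0\<close> by simp
  then have N0: "real N > 0" using N by linarith
  define h where "h = T / real N"
  have h: "h > 0" "h < d" "real N * h = T"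
    using N N0 T \<open>d > 0\<close> by (auto simp: h_def field_simps)
  define Y where "Y k = y (real k * h)" for k
  \<comment> \<open>The inhomogeneity for which the samples satisfy the implicit Euler scheme
    exactly; \<open>z 0 = 0\<close> because \<open>0 - 1 = 0\<close> and
    \<open>Y 0 = 0\<close>.\<close>
  define z where "z k = (1 / h) *\<^sub>R (Y k - Y (k - 1)) - M *v Y k" for k
  define S where "S k = {real k * h..real (Suc k) * h}" for k
  have S: "S k \<subseteq> {0..T}" if "k < N" for k
  proof -
    have "real (Suc k) * h \<le> real N * h" using that h(1) by (intro mult_right_mono) auto
    then show ?thesis using h by (auto simp: S_def intro: order_trans[rotated])
  qed
  have near: "norm (y t - Y (Suc k)) \<le> \<delta>" if "k < N" "t \<in> S k" for k t
  proof -
    have "real (Suc k) * h \<in> S k" using h(1) by (simp add: S_def algebra_simps)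
    then have "t \<in> {0..T}" "real (Suc k) * h \<in> {0..T}" using S[OF that(1)] that(2) by blast+
    moreover have "\<bar>t - real (Suc k) * h\<bar> < d" using that(2) h by (simp add: S_def algebra_simps)
    ultimately show ?thesis unfolding Y_def by (intro less_imp_le d)
  qed
  have const: "((\<lambda>t. c) has_integral h * c) (S k)" for c :: real and k
    using has_integral_const_real[of c "real k * h" "real (Suc k) * h"] h(1)
    by (simp add: S_def algebra_simps)
  define q where "q k = integral (S k) (\<lambda>t. (norm (f t))\<^sup>2)" for k
  have q: "((\<lambda>t. (norm (f t))\<^sup>2) has_integral q k) (S k)" if "k < N" for k
    unfolding q_def using Q S[OF that] integrable_on_subinterval[of _ "{0..T}"]
    by (metis S_def has_integral_integrable integrable_integral)
  have sum_q: "(\<Sum>k<N. q k) = Q"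
    using has_integral_uniform_grid[of h N "\<lambda>t. (norm (f t))\<^sup>2" q] q h Q
    by (auto simp: S_def intro: has_integral_unique)
  define j where "j k = integral (S k) (\<lambda>t. (norm (y t))\<^sup>2)" for k
  have j: "((\<lambda>t. (norm (y t))\<^sup>2) has_integral j k) (S k)" if "k < N" for k
    unfolding j_def using J S[OF that] integrable_on_subinterval[of _ "{0..T}"]
    by (metis S_def has_integral_integrable integrable_integral)
  have sum_j: "(\<Sum>k<N. j k) = J"
    using has_integral_uniform_grid[of h N "\<lambda>t. (norm (y t))\<^sup>2" j] j h J
    by (auto simp: S_def intro: has_integral_unique)
  have Y_bound: "j k \<le> h * ((1 + \<eta>) * (norm (Y (Suc k)))\<^sup>2 + (1 + 1 / \<eta>) * \<delta>\<^sup>2)" if "k < N" for k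
  proof (rule has_integral_le[OF j[OF that] const])
    fix t assume t: "t \<in> S k"
    show "(norm (y t))\<^sup>2 \<le> (1 + \<eta>) * (norm (Y (Suc k)))\<^sup>2 + (1 + 1 / \<eta>) * \<delta>\<^sup>2"
      using near[OF that t] norm_triangle_ineq2[of "y t" "Y (Suc k)"]
      by (intro norm_power2_le_weighted[OF \<eta>]) simp
  qed
  have z_bound: "h * (norm (z (Suc k)))\<^sup>2 \<le> (1 + \<eta>) * q k + (1 + 1 / \<eta>) * (h * (norm M * \<delta>)\<^sup>2)"
    if k: "k < N" for k
  proof -
    \<comment> \<open>The error of freezing \<open>M *v y t\<close> at the right endpoint.
      Integrating the equation over the cell shows that \<open>f\<close> has integral
      \<open>h *\<^sub>R z (Suc k) - IG\<close>.\<close>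
    define G where "G t = M *v y t - M *v Y (Suc k)" for t
    have contG: "continuous_on (S k) G"
      unfolding G_def
      by (intro continuous_intros bounded_linear.continuous_on[OF matrix_vector_mul_bounded_linear]
          continuous_on_subset[OF cont S[OF k]])
    then obtain IG where IG: "(G has_integral IG) (S k)"
      unfolding S_def using integrable_continuous_real by blast
    have G_le: "norm (G t) \<le> norm M * \<delta>" if "t \<in> S k" for t
    proof -
      have "norm (G t) = norm (M *v (y t - Y (Suc k)))" by (simp add: G_def matrix_vector_mult_diff_distrib)
      also have "\<dots> \<le> norm M * norm (y t - Y (Suc k))" by (rule norm_matrix_vector_mult_le)
      also have "\<dots> \<le> norm M * \<delta>" using near[OF k that] by (simp add: mult_left_mono)
      finally show ?thesis .
    qed
    have IG_le: "norm IG \<le> norm M * \<delta> * h"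
      using has_integral_bound_real[of "norm M * \<delta>" "{}" G IG "real k * h" "real (Suc k) * h"] IG G_le \<delta> h(1)
      by (simp add: S_def algebra_simps)
    have F: "((\<lambda>t. M *v y t + f t) has_integral (Y (Suc k) - Y k)) (S k)"
      using S[OF k] h(1) unfolding S_def Y_def by (intro ftc) (auto simp: mult_right_mono)
    have Mconst: "((\<lambda>t. M *v Y (Suc k)) has_integral h *\<^sub>R (M *v Y (Suc k))) (S k)"
      using has_integral_const_real[of "M *v Y (Suc k)" "real k * h" "real (Suc k) * h"] h(1)
      by (simp add: S_def algebra_simps)
    have "((\<lambda>t. (M *v y t + f t) - G t - M *v Y (Suc k)) has_integral
        (Y (Suc k) - Y k) - IG - h *\<^sub>R (M *v Y (Suc k))) (S k)"
      by (intro has_integral_diff F IG Mconst)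
    moreover have "(M *v y t + f t) - G t - M *v Y (Suc k) = f t" for t by (simp add: G_def)
    ultimately have f: "(f has_integral (Y (Suc k) - Y k) - IG - h *\<^sub>R (M *v Y (Suc k))) (S k)"
      by (simp only:)
    have "(Y (Suc k) - Y k) - IG - h *\<^sub>R (M *v Y (Suc k)) = h *\<^sub>R z (Suc k) - IG"
      using h(1) by (simp add: z_def scaleR_diff_right)
    with f have f: "(f has_integral h *\<^sub>R z (Suc k) - IG) (S k)" by simp
    have "(norm (h *\<^sub>R z (Suc k) - IG))\<^sup>2 \<le> (real (Suc k) * h - real k * h) * q k"
      using h(1) f q[OF k] unfolding S_def by (intro norm_integral_power2_le) auto
    then have 1: "(norm (h *\<^sub>R z (Suc k) - IG))\<^sup>2 \<le> h * q k" by (simp add: algebra_simps)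
    have "(norm (h *\<^sub>R z (Suc k)))\<^sup>2 \<le> (1 + \<eta>) * (norm (h *\<^sub>R z (Suc k) - IG))\<^sup>2
        + (1 + 1 / \<eta>) * (norm M * \<delta> * h)\<^sup>2"
      using IG_le norm_triangle_ineq2[of "h *\<^sub>R z (Suc k)" IG] norm_triangle_sub[of "h *\<^sub>R z (Suc k)" IG]
      by (intro norm_power2_le_weighted[OF \<eta>]) linarith
    also have "\<dots> \<le> (1 + \<eta>) * (h * q k) + (1 + 1 / \<eta>) * (norm M * \<delta> * h)\<^sup>2"
      using 1 \<eta> by simp
    \<comment> \<open>Both sides carry a factor \<open>h\<close>; cancelling it leaves the left side
      with the weight of a Riemann sum.\<close>
    finally have "h * (h * (norm (z (Suc k)))\<^sup>2) \<le>
        h * ((1 + \<eta>) * q k + (1 + 1 / \<eta>) * (h * (norm M * \<delta>)\<^sup>2))"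
      using h(1) by (simp add: power2_eq_square algebra_simps)
    then show ?thesis using h(1) by (simp only: mult_le_cancel_left_pos)
  qed
  have shift: "(\<Sum>k\<le>N. g k) = g 0 + (\<Sum>k<N. g (Suc k))" for g :: "nat \<Rightarrow> real"
    unfolding lessThan_Suc_atMost[symmetric] by (rule sum.lessThan_Suc_shift)
  have Y0: "Y 0 = 0" by (simp add: Y_def y0)
  have z0: "z 0 = 0" by (simp add: z_def Y0)
  have "\<epsilon>\<^sup>2 * (\<Sum>k\<le>N. (norm (Y k))\<^sup>2) \<le> (\<Sum>k\<le>N. (norm (z k))\<^sup>2)"
    by (rule implicit_euler_l2_bound[OF M \<epsilon> h(1) Y0 z_def])
  \<comment> \<open>Both terms of index 0 vanish, which aligns the sums with the right endpoints of
    the cells.\<close>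
  then have discrete: "\<epsilon>\<^sup>2 * (\<Sum>k<N. (norm (Y (Suc k)))\<^sup>2) \<le> (\<Sum>k<N. (norm (z (Suc k)))\<^sup>2)"
    by (simp add: shift Y0 z0)
  have hN: "h * real N = T" using h(3) by (simp add: mult.commute)
  have "J \<le> (\<Sum>k<N. h * ((1 + \<eta>) * (norm (Y (Suc k)))\<^sup>2 + (1 + 1 / \<eta>) * \<delta>\<^sup>2))"
    unfolding sum_j[symmetric] by (intro sum_mono Y_bound) simp
  also have "\<dots> = (\<Sum>k<N. ((1 + \<eta>) * h) * (norm (Y (Suc k)))\<^sup>2) + (\<Sum>k<N. h * ((1 + 1 / \<eta>) * \<delta>\<^sup>2))"
    unfolding sum.distrib[symmetric] by (intro sum.cong) (simp_all only: algebra_simps)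
  also have "\<dots> = (1 + \<eta>) * h * (\<Sum>k<N. (norm (Y (Suc k)))\<^sup>2) + (1 + 1 / \<eta>) * (T * \<delta>\<^sup>2)"
    unfolding sum_distrib_left[symmetric] by (simp add: hN)
  finally have J_le: "\<epsilon>\<^sup>2 * J \<le> \<epsilon>\<^sup>2 * ((1 + \<eta>) * h * (\<Sum>k<N. (norm (Y (Suc k)))\<^sup>2) + (1 + 1 / \<eta>) * (T * \<delta>\<^sup>2))"
    by (intro mult_left_mono) auto
  have "(\<Sum>k<N. h * (norm (z (Suc k)))\<^sup>2) \<le> (\<Sum>k<N. (1 + \<eta>) * q k + h * ((1 + 1 / \<eta>) * (norm M * \<delta>)\<^sup>2))"
    using z_bound by (intro sum_mono) (simp add: mult_ac)
  also have "\<dots> = (1 + \<eta>) * Q + (1 + 1 / \<eta>) * (T * (norm M * \<delta>)\<^sup>2)"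
    unfolding sum.distrib sum_distrib_left[symmetric] sum_q by (simp add: hN)
  finally have z_le: "h * (\<Sum>k<N. (norm (z (Suc k)))\<^sup>2) \<le> (1 + \<eta>) * Q + (1 + 1 / \<eta>) * (T * (norm M * \<delta>)\<^sup>2)"
    by (simp add: sum_distrib_left)
  have "(1 + \<eta>) * (h * (\<epsilon>\<^sup>2 * (\<Sum>k<N. (norm (Y (Suc k)))\<^sup>2)))
      \<le> (1 + \<eta>) * (h * (\<Sum>k<N. (norm (z (Suc k)))\<^sup>2))"
    using discrete h(1) \<eta> by (intro mult_left_mono) auto
  also have "\<dots> \<le> (1 + \<eta>) * ((1 + \<eta>) * Q + (1 + 1 / \<eta>) * (T * (norm M * \<delta>)\<^sup>2))"
    using z_le \<eta> by (intro mult_left_mono) auto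
  finally have "(1 + \<eta>) * (h * (\<epsilon>\<^sup>2 * (\<Sum>k<N. (norm (Y (Suc k)))\<^sup>2)))
      \<le> (1 + \<eta>) * ((1 + \<eta>) * Q + (1 + 1 / \<eta>) * (T * (norm M * \<delta>)\<^sup>2))" .
  note bound = add_right_mono[OF this]
  have eq: "\<epsilon>\<^sup>2 * ((1 + \<eta>) * h * x + c) = (1 + \<eta>) * (h * (\<epsilon>\<^sup>2 * x)) + \<epsilon>\<^sup>2 * c" for x c
    by (simp add: algebra_simps)
  show ?thesis using J_le unfolding eq by (rule order_trans[OF _ bound])
qed

text \<open>First \<open>\<delta>\<close> tends to 0 with \<open>\<eta>\<close> fixed, then
  \<open>\<eta>\<close> does; the order matters because the errors carry the factor
  \<open>1 + 1 / \<eta>\<close>.\<close>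

lemma L2_bound_finite_horizon:
  fixes M :: "complex^'n^'n" and y f :: "real \<Rightarrow> complex^'n"
  assumes "resolvent_bounded \<epsilon> M" and \<epsilon>: "0 < \<epsilon>" and "0 < T" and "y 0 = 0"
    and "continuous_on {0..T} y"
    and "\<And>a b. 0 \<le> a \<Longrightarrow> a \<le> b \<Longrightarrow> b \<le> T \<Longrightarrow>
      ((\<lambda>t. M *v y t + f t) has_integral (y b - y a)) {a..b}"
    and "((\<lambda>t. (norm (f t))\<^sup>2) has_integral Q) {0..T}"
    and "((\<lambda>t. (norm (y t))\<^sup>2) has_integral J) {0..T}"
  shows "\<epsilon>\<^sup>2 * J \<le> Q"
proof -
  have *: "\<epsilon>\<^sup>2 * J \<le> (1 + \<eta>) * ((1 + \<eta>) * Q)" if \<eta>: "\<eta> > 0" for \<eta>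
  proof (rule tendsto_lowerbound)
    show "((\<lambda>\<delta>. (1 + \<eta>) * ((1 + \<eta>) * Q + (1 + 1 / \<eta>) * (T * (norm M * \<delta>)\<^sup>2))
        + \<epsilon>\<^sup>2 * ((1 + 1 / \<eta>) * (T * \<delta>\<^sup>2))) \<longlongrightarrow> (1 + \<eta>) * ((1 + \<eta>) * Q)) (at_right 0)"
      by (auto intro!: tendsto_eq_intros)
    show "\<forall>\<^sub>F \<delta> in at_right 0. \<epsilon>\<^sup>2 * J \<le> (1 + \<eta>) * ((1 + \<eta>) * Q + (1 + 1 / \<eta>) * (T * (norm M * \<delta>)\<^sup>2))
        + \<epsilon>\<^sup>2 * ((1 + 1 / \<eta>) * (T * \<delta>\<^sup>2))"
      by (rule eventually_mono[OF eventually_at_right_less]) (rule sampled_l2_bound[OF assms _ \<eta>])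
  qed simp
  show ?thesis
  proof (rule tendsto_lowerbound)
    show "((\<lambda>\<eta>. (1 + \<eta>) * ((1 + \<eta>) * Q)) \<longlongrightarrow> Q) (at_right 0)"
      by (auto intro!: tendsto_eq_intros)
    show "\<forall>\<^sub>F \<eta> in at_right 0. \<epsilon>\<^sup>2 * J \<le> (1 + \<eta>) * ((1 + \<eta>) * Q)"
      by (rule eventually_mono[OF eventually_at_right_less]) (rule *)
  qed simp
qed

section \<open>Lebesgue integrals of solutions on finite and infinite horizons\<close>

lemma nn_integral_lebesgue_has_integral:
  fixes g :: "real \<Rightarrow> real"
  assumes "\<And>t. 0 \<le> g t" and "(g has_integral I) X"
  shows "(\<integral>\<^sup>+t\<in>X. ennreal (g t) \<partial>lebesgue) = ennreal I"
  using nn_integral_has_integral_lebesgue'[of X g I] assms by (simp add: nn_integral_completion)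

lemma solves_ivp_has_integral:
  fixes M :: "complex^'n^'n"
  assumes "solves_ivp M f y" and "0 \<le> a" "a \<le> b"
  shows "((\<lambda>t. M *v y t + f t) has_integral (y b - y a)) {a..b}"
proof -
  obtain N where N: "N \<in> null_sets lebesgue"
    "{t. \<not> (t > 0 \<longrightarrow> (y has_vector_derivative (M *v y t + f t)) (at t))} \<subseteq> N"
    using assms(1) unfolding solves_ivp_def eventually_ae_filter by auto
  show ?thesis
  proof (rule fundamental_theorem_of_calculus_abs_continuous[OF \<open>a \<le> b\<close>])
    show "abs_continuous_between a b y"
      using assms abs_continuous_between_subset[of 0 b y a b] by (simp add: solves_ivp_def)
    \<comment> \<open>The differential equation is imposed only for \<open>t > 0\<close>, so the
      initial time joins the exceptional set.\<close>
    show "negligible (insert 0 N)" using N(1) by (simp add: negligible_iff_null_sets)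
    show "(y has_vector_derivative (M *v y t + f t)) (at t within {a..b})"
      if "t \<in> {a..b} - insert 0 N" for t
    proof (rule has_vector_derivative_at_within)
      have "t > 0" "t \<notin> N" using that \<open>0 \<le> a\<close> by auto
      then show "(y has_vector_derivative (M *v y t + f t)) (at t)" using N(2) by blast
    qed
  qed
qed

text \<open>An infinite right side is trivial. Otherwise measurability of \<open>f\<close> turns the
  finite Lebesgue integral into a gauge integral, the form taken by
  \<open>L2_bound_finite_horizon\<close>.\<close>

lemma solves_ivp_nn_integral_le:
  fixes M :: "complex^'n^'n"
  assumes M: "resolvent_bounded \<epsilon> M" and \<epsilon>: "0 < \<epsilon>" and y: "solves_ivp M f y" and r: "0 < r"
  shows "(\<integral>\<^sup>+t\<in>{0..r}. ennreal ((norm (y t))\<^sup>2) \<partial>lebesgue)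
    \<le> ennreal (1 / \<epsilon>\<^sup>2) * (\<integral>\<^sup>+t\<in>{0..r}. ennreal ((norm (f t))\<^sup>2) \<partial>lebesgue)"
proof (cases "(\<integral>\<^sup>+t\<in>{0..r}. ennreal ((norm (f t))\<^sup>2) \<partial>lebesgue) = \<infinity>")
  case True
  then show ?thesis using \<epsilon> by (simp add: ennreal_mult_top)
next
  case False
  then obtain Q where Q: "0 \<le> Q" "(\<integral>\<^sup>+t\<in>{0..r}. ennreal ((norm (f t))\<^sup>2) \<partial>lebesgue) = ennreal Q"
    by (cases "\<integral>\<^sup>+t\<in>{0..r}. ennreal ((norm (f t))\<^sup>2) \<partial>lebesgue") auto
  have cont: "continuous_on {0..r} y"
    using y r by (auto simp: solves_ivp_def intro: abs_continuous_between_imp_continuous_on)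
  obtain Iy where "((\<lambda>t. M *v y t) has_integral Iy) {0..r}"
    using integrable_continuous_real[OF bounded_linear.continuous_on[OF matrix_vector_mul_bounded_linear cont]]
    by blast
  \<comment> \<open>Measurability of \<open>f\<close> is recovered from the equation:
    \<open>f\<close> is the difference of the integrable \<open>M *v y t + f t\<close> and the
    continuous \<open>M *v y t\<close>.\<close>
  from has_integral_diff[OF solves_ivp_has_integral[OF y order_refl, of r] this]
  have "(f has_integral (y r - y 0 - Iy)) {0..r}" using r by simp
  then have [measurable]: "(\<lambda>t. indicator {0..r} t *\<^sub>R f t) \<in> lebesgue \<rightarrow>\<^sub>M borel"
    by (rule has_integral_implies_lebesgue_measurable)
  have "(\<lambda>t. (norm (indicator {0..r} t *\<^sub>R f t))\<^sup>2) \<in> lebesgue \<rightarrow>\<^sub>M borel" by measurable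
  moreover have "(\<integral>\<^sup>+t. ennreal ((norm (indicator {0..r} t *\<^sub>R f t))\<^sup>2) \<partial>lebesgue) = ennreal Q"
    unfolding Q(2)[symmetric] by (intro nn_integral_cong) (simp add: indicator_def)
  ultimately have "((\<lambda>t. (norm (indicator {0..r} t *\<^sub>R f t))\<^sup>2) has_integral Q) UNIV"
    using Q(1) by (subst has_integral_iff_nn_integral_lebesgue) auto
  moreover have "(norm (indicator {0..r} t *\<^sub>R f t))\<^sup>2 = (if t \<in> {0..r} then (norm (f t))\<^sup>2 else 0)" for t
    by (simp add: indicator_def)
  ultimately have fQ: "((\<lambda>t. (norm (f t))\<^sup>2) has_integral Q) {0..r}"
    by (simp only: has_integral_restrict_UNIV)
  have "(\<lambda>t. (norm (y t))\<^sup>2) integrable_on {0..r}"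
    by (intro integrable_continuous_real continuous_intros cont)
  then obtain J where J: "((\<lambda>t. (norm (y t))\<^sup>2) has_integral J) {0..r}" by blast
  have "\<epsilon>\<^sup>2 * J \<le> Q"
    using y by (intro L2_bound_finite_horizon[OF M \<epsilon> r _ cont _ fQ J] solves_ivp_has_integral[OF y])
      (simp_all add: solves_ivp_def)
  then have "J \<le> 1 / \<epsilon>\<^sup>2 * Q" using \<epsilon> by (simp add: field_simps)
  then show ?thesis
    unfolding Q(2) nn_integral_lebesgue_has_integral[OF zero_le_power2 J]
    using \<epsilon> Q(1) by (simp add: ennreal_mult[symmetric] ennreal_leI)
qed

text \<open>Monotone convergence over growing horizons, with a constant that does not depend on the
  horizon.\<close>

lemma solves_ivp_nn_integral_le_infinite:
  fixes M :: "complex^'n^'n"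
  assumes M: "resolvent_bounded \<epsilon> M" and \<epsilon>: "0 < \<epsilon>" and y: "solves_ivp M f y"
  shows "(\<integral>\<^sup>+t\<in>{0..}. ennreal ((norm (y t))\<^sup>2) \<partial>lebesgue)
    \<le> ennreal (1 / \<epsilon>\<^sup>2) * (\<integral>\<^sup>+t\<in>{0..}. ennreal ((norm (f t))\<^sup>2) \<partial>lebesgue)"
proof -
  \<comment> \<open>\<open>Suc n\<close> makes every horizon positive, as the finite estimate
    requires.\<close>
  define g where "g n t = ennreal ((norm (y t))\<^sup>2) * indicator {0..real (Suc n)} t" for n t
  have "incseq g"
    by (intro incseq_SucI le_funI) (auto simp: g_def indicator_def)
  have meas: "g n \<in> borel_measurable lebesgue" for n
  proof -
    have cont: "continuous_on {0..real (Suc n)} y"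
      using y by (auto simp: solves_ivp_def intro: abs_continuous_between_imp_continuous_on)
    have "(\<lambda>t. (norm (y t))\<^sup>2) integrable_on {0..real (Suc n)}"
      by (intro integrable_continuous_real continuous_intros cont)
    then obtain J where "((\<lambda>t. (norm (y t))\<^sup>2) has_integral J) {0..real (Suc n)}" by blast
    then have [measurable]: "(\<lambda>t. indicator {0..real (Suc n)} t *\<^sub>R (norm (y t))\<^sup>2) \<in> lebesgue \<rightarrow>\<^sub>M borel"
      by (rule has_integral_implies_lebesgue_measurable)
    have "g n = (\<lambda>t. ennreal (indicator {0..real (Suc n)} t *\<^sub>R (norm (y t))\<^sup>2))"
      by (auto simp: g_def indicator_def)
    also have "\<dots> \<in> borel_measurable lebesgue" by measurable
    finally show ?thesis .
  qed
  have "(SUP n. g n t) = ennreal ((norm (y t))\<^sup>2) * indicator {0..} t" for t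
  proof (rule antisym)
    show "(SUP n. g n t) \<le> ennreal ((norm (y t))\<^sup>2) * indicator {0..} t"
      by (intro SUP_least) (auto simp: g_def indicator_def)
    obtain n where "t \<le> real n" using real_arch_simple by blast
    then have "ennreal ((norm (y t))\<^sup>2) * indicator {0..} t \<le> g n t"
      by (auto simp: g_def indicator_def)
    then show "ennreal ((norm (y t))\<^sup>2) * indicator {0..} t \<le> (SUP n. g n t)"
      by (rule SUP_upper2[OF UNIV_I])
  qed
  then have "(\<integral>\<^sup>+t\<in>{0..}. ennreal ((norm (y t))\<^sup>2) \<partial>lebesgue) = (\<integral>\<^sup>+t. (SUP n. g n t) \<partial>lebesgue)"
    by (simp only:)
  also have "\<dots> = (SUP n. integral\<^sup>N lebesgue (g n))"
    by (rule nn_integral_monotone_convergence_SUP[OF \<open>incseq g\<close> meas])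
  also have "\<dots> \<le> ennreal (1 / \<epsilon>\<^sup>2) * (\<integral>\<^sup>+t\<in>{0..}. ennreal ((norm (f t))\<^sup>2) \<partial>lebesgue)"
  proof (rule SUP_least)
    fix n
    have "integral\<^sup>N lebesgue (g n) \<le>
        ennreal (1 / \<epsilon>\<^sup>2) * (\<integral>\<^sup>+t\<in>{0..real (Suc n)}. ennreal ((norm (f t))\<^sup>2) \<partial>lebesgue)"
      unfolding g_def by (rule solves_ivp_nn_integral_le[OF M \<epsilon> y]) simp
    also have "\<dots> \<le> ennreal (1 / \<epsilon>\<^sup>2) * (\<integral>\<^sup>+t\<in>{0..}. ennreal ((norm (f t))\<^sup>2) \<partial>lebesgue)"
      by (intro mult_left_mono nn_integral_mono) (auto simp: indicator_def)
    finally show "integral\<^sup>N lebesgue (g n) \<le> \<dots>" .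
  qed
  finally show ?thesis .
qed

lemma ennreal_sqrt_le:
  assumes "x \<le> ennreal (1 / \<epsilon>\<^sup>2) * z" and \<epsilon>: "0 < \<epsilon>"
  shows "ennreal_sqrt x \<le> ennreal (1 / \<epsilon>) * ennreal_sqrt z"
proof (cases "z = \<infinity>")
  case True
  then show ?thesis using \<epsilon> by (simp add: ennreal_sqrt_def ennreal_mult_top)
next
  case False
  then obtain b where b: "0 \<le> b" "z = ennreal b" by (cases z) auto
  then have x: "x \<le> ennreal (1 / \<epsilon>\<^sup>2 * b)" using assms by (simp add: ennreal_mult[symmetric])
  then obtain a where a: "0 \<le> a" "x = ennreal a" by (cases x) (auto simp: top_unique)
  have "a \<le> b / \<epsilon>\<^sup>2" using x a b by (simp add: ennreal_le_iff)
  then have "sqrt a \<le> sqrt (b / \<epsilon>\<^sup>2)" by (rule real_sqrt_le_mono)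
  also have "\<dots> = sqrt b / \<epsilon>" using \<epsilon> by (simp add: real_sqrt_divide)
  finally have "sqrt a \<le> sqrt b / \<epsilon>" .
  then show ?thesis
    using a b \<epsilon> by (simp add: ennreal_sqrt_def ennreal_mult[symmetric] ennreal_leI)
qed

lemma L2_norm_upto_le:
  fixes M :: "complex^'n^'n"
  assumes M: "resolvent_bounded \<epsilon> M" and \<epsilon>: "0 < \<epsilon>" and y: "solves_ivp M f y" and T: "0 \<le> T"
  shows "L2_norm_upto T y \<le> ennreal (1 / \<epsilon>) * L2_norm_upto T f"
  unfolding L2_norm_upto_def
proof (rule ennreal_sqrt_le[OF _ \<epsilon>])
  show "(\<integral>\<^sup>+t\<in>{t. 0 \<le> t \<and> ereal t \<le> T}. ennreal ((norm (y t))\<^sup>2) \<partial>lebesgue)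
    \<le> ennreal (1 / \<epsilon>\<^sup>2) * (\<integral>\<^sup>+t\<in>{t. 0 \<le> t \<and> ereal t \<le> T}. ennreal ((norm (f t))\<^sup>2) \<partial>lebesgue)"
  proof (cases T)
    case (real r)
    have set_eq: "{t. 0 \<le> t \<and> ereal t \<le> T} = {0..r}" using real by auto
    show ?thesis
    proof (cases "r = 0")
      \<comment> \<open>A horizon of length 0 admits no grid; the left integral is over a single
        point.\<close>
      case True
      have "((\<lambda>t. (norm (y t))\<^sup>2) has_integral 0) {0..r}" using True by (simp add: has_integral_refl)
      then have "(\<integral>\<^sup>+t\<in>{0..r}. ennreal ((norm (y t))\<^sup>2) \<partial>lebesgue) = ennreal 0"
        by (rule nn_integral_lebesgue_has_integral[OF zero_le_power2])
      then show ?thesis unfolding set_eq by simp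
    next
      case False
      then have "r > 0" using T real by simp
      then show ?thesis unfolding set_eq by (rule solves_ivp_nn_integral_le[OF M \<epsilon> y])
    qed
  next
    case PInf
    then have "{t. 0 \<le> t \<and> ereal t \<le> T} = {0..}" by auto
    then show ?thesis using solves_ivp_nn_integral_le_infinite[OF M \<epsilon> y] by simp
  qed (use T in simp)
qed

text \<open>Attainment of the structured radius yields the resolvent bound with the same
  \<open>\<epsilon>\<close> for every admissible \<open>\<Delta>\<close>, including those whose norm
  equals the radius; the estimate depends on \<open>A + \<Delta>\<close> only through this
  bound.\<close>

theorem proposition2p2:
  fixes A :: "complex^'n^'n"
    and S :: "(complex^'n^'n) set"
    and \<epsilon> :: real
    and f :: "real \<Rightarrow> complex^'n"
  assumes "\<And>\<mu>. eigenvalue A \<mu> \<Longrightarrow> Re \<mu> < 0"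
    and "subspace S"
    and "0 < \<epsilon>" and "\<epsilon> < stability_radius A"
  shows "\<forall>\<Delta>\<in>S. ereal (norm \<Delta>) \<le> structured_stability_radius S \<epsilon> A \<longrightarrow>
    (\<forall>y. solves_ivp (A + \<Delta>) f y \<longrightarrow>
      (\<forall>T\<ge>0. L2_norm_upto T y \<le> ennreal (1 / \<epsilon>) * L2_norm_upto T f))"
proof (intro ballI impI allI)
  fix \<Delta> y and T :: ereal
  assume \<Delta>: "\<Delta> \<in> S" "ereal (norm \<Delta>) \<le> structured_stability_radius S \<epsilon> A"
    and y: "solves_ivp (A + \<Delta>) f y" and T: "T \<ge> 0"
  have "resolvent_bounded \<epsilon> (A + \<Delta>)"
    by (rule resolvent_bounded_structured[OF resolvent_bounded_stability_radius[OF assms(1)]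
          assms(3,4,2) \<Delta>])
  then show "L2_norm_upto T y \<le> ennreal (1 / \<epsilon>) * L2_norm_upto T f"
    by (rule L2_norm_upto_le[OF _ assms(3) y T])
qed

end
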